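(* Let $k$ be a field, $n\ge1$ and $A=k[x_1,\ldots,x_n]/\langle x_1\cdots x_n\rangle$. The complex $\mathrm{Hom}_k(\overline{F}_\bullet,A)$ of $k$-vector spaces (with differential $\partial$) is the direct sum of its subcomplexes $M_\gamma$, $\gamma\in\Gamma$: $$\mathrm{Hom}_k(\overline{F}_\bullet,A)=\bigoplus_{\gamma\in\Gamma}M_\gamma.$$
   Context: Put $A^e=A\otimes_k A$. Let $F_\bullet$ be the following free resolution of the $A^e$-module $A$ (with augmentation $\epsilon:F_0=A^e\to A$, $a\otimes b\mapsto ab$): $F_m$ is the free $A^e$-module with basis the symbols $e_It^{(q)}$, where $I\subseteq[n]=\{1,\ldots,n\}$, $q\geq0$, $|I|+2q=m$, and $e_I=e_{i_1}\wedge\cdots\wedge e_{i_s}$ for $I=\{i_1<\cdots<i_s\}$. The differential is $d(e_It^{(q)})=\sum_{j=1}^s(-1)^{j-1}(1\otimes x_{i_j}-x_{i_j}\otimes1)e_{I\smallsetminus\{i_j\}}t^{(q)}+\sum_{j=1}^n(x_1\cdots x_{j-1}\otimes x_{j+1}\cdots x_n)\,e_j\wedge e_I\,t^{(q-1)}$, the second sum being omitted if $q=0$. Let $\overline F_m$ be the $k$-vector space with the same basis as $F_m$; via $\mathrm{Hom}_{A^e}(F_m,A)\cong\mathrm{Hom}_k(\overline F_m,A)$ the maps $f\mapsto f\circ d_{m+1}$ become $k$-linear maps $\partial_{m+1}:\mathrm{Hom}_k(\overline F_m,A)\to\mathrm{Hom}_k(\overline F_{m+1},A)$; write $\partial$ for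 all of them. A $k$-basis of $\mathrm{Hom}_k(\overline F_m,A)$ is given by the standard elements $(e_It^{(q)},\mathbf{x}^\alpha)$, where $|I|+2q=m$ and $\mathbf{x}^\alpha=x_1^{\alpha_1}\cdots x_n^{\alpha_n}$ is a monomial not divisible by $x_1\cdots x_n$; this is the map sending $e_It^{(q)}$ to $\mathbf{x}^\alpha$ and all other basis elements to $0$. Put $\mathrm{supp}(\mathbf{x}^\alpha)=\{i\mid\alpha_i>0\}$ and $\mathrm{sgn}(i,I)=(-1)^{|\{j\in I\mid j<i\}|}$. One has $$\partial(e_It^{(q)},\mathbf{x}^\alpha)=\sum_{i\in I\smallsetminus\mathrm{supp}(\mathbf{x}^\alpha)}\mathrm{sgn}(i,I)\,(e_{I\smallsetminus\{i\}}t^{(q+1)},\mathbf{x}^\alpha\cdot x_1\cdots x_{i-1}x_{i+1}\cdots x_n).$$ $\Gamma$ is the set of standard elements that are not a component of any element of $\mathrm{Im}(\partial)$ (i.e. that do not occur with non-zero coefficient, in the basis of standard elements, in any element of $\mathrm{Im}(\partial)$). For $\gamma=(e_It^{(q)},\mathbf{x}^\alpha)\in\Gamma$, $M_\gamma$ is the subcomplex $$\cdots\to0\to k(e_It^{(q)},\mathbf{x}^\alpha)\to\bigoplus_{i\in I\smallsetminus\mathrm{supp}(\mathbf{x}^\alpha)}k(e_{I\smallsetminus\{i\}}t^{(q+1)},\mathbf{x}^\alpha\cdot x_1\cdots x_{i-1}x_{i+1}\cdots x_n)\to0\to\cdots$$ concentrated in degrees $|I|+2q$ and $|I|+2q+1$,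 with maps the restrictions of $\partial$; here $k(\cdot)$ denotes the $k$-span. *)

theory Defs
  imports Complex_Main "HOL-Library.Poly_Mapping" "HOL-Library.Function_Algebras"
begin

abbreviation "lookup \<equiv> Poly_Mapping.lookup"
abbreviation "keys \<equiv> Poly_Mapping.keys"

definition pscale :: "'r::mult_zero \<Rightarrow> ('b \<Rightarrow>\<^sub>0 'r) \<Rightarrow> ('b \<Rightarrow>\<^sub>0 'r)" where
  "pscale c u = Poly_Mapping.map ((*) c) u"

lemma lookup_pscale [simp]: "lookup (pscale c u) b = c * lookup u b"
  by (auto simp: pscale_def Poly_Mapping.map.rep_eq when_def)

global_interpretation free: module "pscale :: 'r::comm_ring_1 \<Rightarrow> ('b \<Rightarrow>\<^sub>0 'r) \<Rightarrow> ('b \<Rightarrow>\<^sub>0 'r)"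
  by standard (auto intro!: poly_mapping_eqI simp: lookup_add algebra_simps)

definition linext :: "('r::zero \<Rightarrow> 'v \<Rightarrow> 'v) \<Rightarrow> ('b \<Rightarrow> 'v) \<Rightarrow> ('b \<Rightarrow>\<^sub>0 'r) \<Rightarrow> 'v::comm_monoid_add" where
  "linext s f u = (\<Sum>b\<in>keys u. s (lookup u b) (f b))"

definition linear_on ::
  "'u set \<Rightarrow> ('r \<Rightarrow> 'u \<Rightarrow> 'u::plus) \<Rightarrow> ('r \<Rightarrow> 'v \<Rightarrow> 'v::plus) \<Rightarrow> ('u \<Rightarrow> 'v) \<Rightarrow> bool" where
  "linear_on S s\<^sub>1 s\<^sub>2 f \<longleftrightarrow>
     (\<forall>u\<in>S. \<forall>v\<in>S. f (u + v) = f u + f v) \<and> (\<forall>c. \<forall>u\<in>S. f (s\<^sub>1 c u) = s\<^sub>2 c (f u))"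

text \<open>A map defined on a submodule \<open>S\<close> is represented by its extension by zero to the whole
  type, so that the pointwise operations of the function type restrict to the Hom sets.\<close>

definition Hom_on ::
  "'u set \<Rightarrow> ('r \<Rightarrow> 'u \<Rightarrow> 'u::plus) \<Rightarrow> ('r \<Rightarrow> 'v \<Rightarrow> 'v::{plus,zero}) \<Rightarrow> ('u \<Rightarrow> 'v) set" where
  "Hom_on S s\<^sub>1 s\<^sub>2 = {f. linear_on S s\<^sub>1 s\<^sub>2 f \<and> (\<forall>u. u \<notin> S \<longrightarrow> f u = 0)}"

lemma linext_superset:
  assumes "module s" "finite B" "keys u \<subseteq> B"
  shows "linext s f u = (\<Sum>b\<in>B. s (lookup u b) (f b))"
proof -
  interpret module s by fact
  show ?thesis unfolding linext_def
    by (rule sum.mono_neutral_left) (use assms in \<open>auto simp: in_keys_iff\<close>)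
qed

lemma linext_add:
  assumes "module s"
  shows "linext s f (u + v) = linext s f u + linext s f v"
proof -
  interpret module s by fact
  let ?B = "keys u \<union> keys v"
  have "keys (u + v) \<subseteq> ?B" by (rule keys_add)
  then show ?thesis
    by (simp add: linext_superset[OF assms, of ?B] lookup_add scale_left_distrib sum.distrib)
qed

lemma linext_pscale:
  assumes "module s"
  shows "linext s f (pscale c u) = s c (linext s f u)"
proof -
  interpret module s by fact
  have "keys (pscale c u) \<subseteq> keys u" by (auto simp: in_keys_iff)
  then show ?thesis
    by (simp add: linext_superset[OF assms, of "keys u"] scale_sum_right)
qed

lemma linext_single:
  assumes "module s"
  shows "linext s f (Poly_Mapping.single b c) = s c (f b)"
proof -
  interpret module s by fact
  show ?thesis by (simp add: linext_superset[OF assms, of "{b}"])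
qed

lemma linext_diff:
  assumes "module s"
  shows "linext s f (u - v) = linext s f u - linext s f v"
  using linext_add[OF assms, of f "u - v" v] by (simp add: algebra_simps)

text \<open>The index set \<open>[n]\<close> is a type \<open>'n\<close> of classes \<open>finite\<close> and \<open>linorder\<close> (types are nonempty,
  so \<open>n \<ge> 1\<close>), and \<open>('n \<Rightarrow>\<^sub>0 nat) \<Rightarrow>\<^sub>0 'k\<close> with its convolution product is the polynomial
  ring \<open>k[x\<^sub>1,\<dots>,x\<^sub>n]\<close>.\<close>

definition monom :: "('n \<Rightarrow>\<^sub>0 nat) \<Rightarrow> ('n \<Rightarrow>\<^sub>0 nat) \<Rightarrow>\<^sub>0 'k::field" where
  "monom \<alpha> = Poly_Mapping.single \<alpha> 1"

definition unit_exp :: "'n \<Rightarrow> 'n \<Rightarrow>\<^sub>0 nat" where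
  "unit_exp i = Poly_Mapping.single i 1"

definition var_prod :: "('n::finite \<Rightarrow>\<^sub>0 nat) \<Rightarrow>\<^sub>0 'k::field" where
  "var_prod = (\<Prod>i\<in>UNIV. monom (unit_exp i))"

quotient_type (overloaded) ('n, 'k) qalg = "('n::finite \<Rightarrow>\<^sub>0 nat) \<Rightarrow>\<^sub>0 'k::field" / "\<lambda>p q. var_prod dvd p - q"
proof (rule equivpI)
  show "reflp (\<lambda>p q :: ('n \<Rightarrow>\<^sub>0 nat) \<Rightarrow>\<^sub>0 'k. var_prod dvd p - q)"
    by (simp add: reflp_def)
  show "symp (\<lambda>p q :: ('n \<Rightarrow>\<^sub>0 nat) \<Rightarrow>\<^sub>0 'k. var_prod dvd p - q)"
    by (metis dvd_minus_iff minus_diff_eq sympI)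
  show "transp (\<lambda>p q :: ('n \<Rightarrow>\<^sub>0 nat) \<Rightarrow>\<^sub>0 'k. var_prod dvd p - q)"
  proof (rule transpI)
    fix p q r :: "('n \<Rightarrow>\<^sub>0 nat) \<Rightarrow>\<^sub>0 'k"
    assume "var_prod dvd p - q" "var_prod dvd q - r"
    from dvd_add[OF this] show "var_prod dvd p - r" by simp
  qed
qed

lemma prod_single:
  "finite S \<Longrightarrow> (\<Prod>i\<in>S. Poly_Mapping.single (f i) (1::'k::comm_semiring_1)) =
     Poly_Mapping.single (\<Sum>i\<in>S. f i) 1"
  by (induction rule: finite_induct) (auto simp: mult_single)

lemma not_var_prod_dvd_1: "\<not> (var_prod :: ('n::finite \<Rightarrow>\<^sub>0 nat) \<Rightarrow>\<^sub>0 'k::field) dvd 1"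
proof
  assume "(var_prod :: ('n \<Rightarrow>\<^sub>0 nat) \<Rightarrow>\<^sub>0 'k) dvd 1"
  then obtain r where r: "(1 :: ('n \<Rightarrow>\<^sub>0 nat) \<Rightarrow>\<^sub>0 'k) = var_prod * r" by (elim dvdE)
  let ?e = "\<Sum>i\<in>UNIV. unit_exp i :: 'n \<Rightarrow>\<^sub>0 nat"
  have "keys (var_prod :: ('n \<Rightarrow>\<^sub>0 nat) \<Rightarrow>\<^sub>0 'k) = {?e}"
    by (simp add: var_prod_def monom_def prod_single)
  moreover have "0 \<in> keys (1 :: ('n \<Rightarrow>\<^sub>0 nat) \<Rightarrow>\<^sub>0 'k)" by simp
  ultimately obtain b where b: "0 = ?e + b"
    using keys_mult[of "var_prod :: ('n \<Rightarrow>\<^sub>0 nat) \<Rightarrow>\<^sub>0 'k" r] r by auto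
  have "lookup ?e (undefined::'n) = 1"
    by (simp add: lookup_sum unit_exp_def lookup_single when_def)
  then have "lookup (?e + b) (undefined::'n) \<noteq> 0" by (simp add: lookup_add)
  then show False using b by (metis lookup_zero)
qed

instantiation qalg :: (finite, field) comm_ring_1
begin

lift_definition zero_qalg :: "('a, 'b) qalg" is 0 .
lift_definition one_qalg :: "('a, 'b) qalg" is 1 .
lift_definition plus_qalg :: "('a, 'b) qalg \<Rightarrow> ('a, 'b) qalg \<Rightarrow> ('a, 'b) qalg" is "(+)"
  by (metis add_diff_add dvd_add)
lift_definition minus_qalg :: "('a, 'b) qalg \<Rightarrow> ('a, 'b) qalg \<Rightarrow> ('a, 'b) qalg" is "(-)"
proof -
  fix p q r s :: "('a \<Rightarrow>\<^sub>0 nat) \<Rightarrow>\<^sub>0 'b"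
  assume "var_prod dvd p - q" "var_prod dvd r - s"
  from dvd_diff[OF this] show "var_prod dvd p - r - (q - s)" by (simp add: algebra_simps)
qed
lift_definition uminus_qalg :: "('a, 'b) qalg \<Rightarrow> ('a, 'b) qalg" is uminus
  by (metis add_uminus_conv_diff dvd_minus_iff minus_diff_minus)
lift_definition times_qalg :: "('a, 'b) qalg \<Rightarrow> ('a, 'b) qalg \<Rightarrow> ('a, 'b) qalg" is "(*)"
proof -
  fix p q r s :: "('a \<Rightarrow>\<^sub>0 nat) \<Rightarrow>\<^sub>0 'b"
  assume "var_prod dvd p - q" "var_prod dvd r - s"
  then have "var_prod dvd (p - q) * r + q * (r - s)" by simp
  then show "var_prod dvd p * r - q * s" by (simp add: algebra_simps)
qed

instance
proof
  show "(0::('a, 'b) qalg) \<noteq> 1"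
    by transfer (metis diff_0 dvd_minus_iff not_var_prod_dvd_1)
qed (transfer; simp add: algebra_simps)+

end

lift_definition qscale :: "'k::field \<Rightarrow> ('n::finite, 'k) qalg \<Rightarrow> ('n, 'k) qalg" is pscale
proof -
  fix c :: 'k and p q :: "('n \<Rightarrow>\<^sub>0 nat) \<Rightarrow>\<^sub>0 'k"
  assume "var_prod dvd p - q"
  then have "var_prod dvd Poly_Mapping.single 0 c * (p - q)" by simp
  then show "var_prod dvd pscale c p - pscale c q"
    by (simp add: pscale_def mult_map_scale_conv_mult right_diff_distrib)
qed

global_interpretation qalg: vector_space "qscale :: 'k::field \<Rightarrow> ('n::finite, 'k) qalg \<Rightarrow> ('n, 'k) qalg"
  by standard (transfer; simp add: free.scale_right_distrib free.scale_left_distrib)+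

lemma qscale_mult_left: "qscale c a * b = qscale c (a * b)"
  by transfer (simp add: pscale_def mult_map_scale_conv_mult mult.assoc)

lemma qscale_mult_right: "a * qscale c b = qscale c (a * b)"
  by (metis qscale_mult_left mult.commute)

lift_definition qmonom :: "('n::finite \<Rightarrow>\<^sub>0 nat) \<Rightarrow> ('n, 'k::field) qalg" is monom .

text \<open>The free \<open>k\<close>-vector space on \<open>A \<times> A\<close> is made a ring by using the multiplicative monoid
  \<open>A \<times> A\<close> as its basis. \<open>Poly_Mapping\<close> forms the convolution product over an additive monoid,
  so this product is written as \<open>+\<close> on the type \<open>pure\<close> of symbols \<open>a \<otimes> b\<close>.\<close>

datatype 'a pure = Pure (left: 'a) (right: 'a)

instantiation pure :: (comm_monoid_mult) comm_monoid_add
begin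
definition "0 = Pure 1 1"
definition "x + y = Pure (left x * left y) (right x * right y)"
instance by standard (auto simp: zero_pure_def plus_pure_def ac_simps)
end

lemma left_0: "left 0 = 1" and right_0: "right 0 = 1"
  by (simp_all add: zero_pure_def)

abbreviation pure_tensor :: "('n::finite, 'k::field) qalg \<Rightarrow> ('n, 'k) qalg \<Rightarrow> ('n, 'k) qalg pure \<Rightarrow>\<^sub>0 'k" where
  "pure_tensor a b \<equiv> Poly_Mapping.single (Pure a b) 1"

definition bilinearity :: "(('n::finite, 'k::field) qalg pure \<Rightarrow>\<^sub>0 'k) set" where
  "bilinearity = free.span (
     {pure_tensor (a + a') b - pure_tensor a b - pure_tensor a' b | a a' b. True} \<union>
     {pure_tensor a (b + b') - pure_tensor a b - pure_tensor a b' | a b b'. True} \<union>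
     {pure_tensor (qscale c a) b - pscale c (pure_tensor a b) | a b c. True} \<union>
     {pure_tensor a (qscale c b) - pscale c (pure_tensor a b) | a b c. True})"

lemma pscale_mult_left: "pscale c u * v = pscale c (u * (v :: 'b::comm_monoid_add \<Rightarrow>\<^sub>0 'r::comm_ring_1))"
  by (simp add: pscale_def mult_map_scale_conv_mult mult.assoc)

lemma pscale_mult_right: "u * pscale c v = pscale c (u * (v :: 'b::comm_monoid_add \<Rightarrow>\<^sub>0 'r::comm_ring_1))"
  by (metis pscale_mult_left mult.commute)

lemma pscale_single: "pscale c (Poly_Mapping.single b d) = Poly_Mapping.single b (c * d)"
  by (auto intro!: poly_mapping_eqI simp: lookup_single when_def)

lemma poly_mapping_as_linext: "u = (\<Sum>b\<in>keys u. pscale (lookup u b) (Poly_Mapping.single b (1::'r::comm_ring_1)))"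
  by (auto intro!: poly_mapping_eqI simp: lookup_sum lookup_single when_def in_keys_iff
      if_distrib[where f = "\<lambda>x. _ * x"] sum.delta cong: if_cong)

lemma bilinearity_ideal_single:
  assumes "u \<in> bilinearity"
  shows "pure_tensor a b * u \<in> bilinearity"
  using assms unfolding bilinearity_def
proof (induction rule: free.span_induct_alt)
  case base
  then show ?case by (simp add: free.span_zero)
next
  case (step c x y)
  let ?G = "{pure_tensor (a + a') b - pure_tensor a b - pure_tensor a' b | a a' b. True} \<union>
     {pure_tensor a (b + b') - pure_tensor a b - pure_tensor a b' | a b b'. True} \<union>
     {pure_tensor (qscale c a) b - pscale c (pure_tensor a b) | a b c. True} \<union>
     {pure_tensor a (qscale c b) - pscale c (pure_tensor a b) | a b c. True}"
  have "pure_tensor a b * x \<in> ?G"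
    using step(1)
    by (auto simp: right_diff_distrib distrib_left pscale_mult_right mult_single plus_pure_def
        qscale_mult_left qscale_mult_right) blast+
  then have "pure_tensor a b * x \<in> free.span ?G" by (rule free.span_base)
  then show ?case
    using step(2) by (simp add: distrib_left pscale_mult_right free.span_add free.span_scale)
qed

lemma bilinearity_0: "0 \<in> bilinearity"
  unfolding bilinearity_def by (rule free.span_zero)

lemma bilinearity_add: "u \<in> bilinearity \<Longrightarrow> v \<in> bilinearity \<Longrightarrow> u + v \<in> bilinearity"
  unfolding bilinearity_def by (rule free.span_add)

lemma bilinearity_uminus: "u \<in> bilinearity \<Longrightarrow> - u \<in> bilinearity"
  unfolding bilinearity_def by (rule free.span_neg)

lemma bilinearity_pscale: "u \<in> bilinearity \<Longrightarrow> pscale c u \<in> bilinearity"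
  unfolding bilinearity_def by (rule free.span_scale)

lemma bilinearity_sum: "(\<And>x. x \<in> S \<Longrightarrow> f x \<in> bilinearity) \<Longrightarrow> sum f S \<in> bilinearity"
  unfolding bilinearity_def by (rule free.span_sum)

lemma bilinearity_ideal:
  assumes "u \<in> bilinearity"
  shows "w * u \<in> bilinearity"
proof -
  have "pscale c (Poly_Mapping.single p 1) * u \<in> bilinearity" for c p
    unfolding pscale_mult_left
    using bilinearity_ideal_single[OF assms, of "left p" "right p"]
    by (intro bilinearity_pscale) simp
  then have "(\<Sum>b\<in>keys w. pscale (lookup w b) (Poly_Mapping.single b 1) * u) \<in> bilinearity"
    by (intro bilinearity_sum)
  then have "(\<Sum>b\<in>keys w. pscale (lookup w b) (Poly_Mapping.single b 1)) * u \<in> bilinearity"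
    by (simp only: sum_distrib_right)
  moreover have "(\<Sum>b\<in>keys w. pscale (lookup w b) (Poly_Mapping.single b 1)) = w"
    by (rule poly_mapping_as_linext[symmetric])
  ultimately show ?thesis by metis
qed

quotient_type (overloaded) ('n, 'k) qenv = "('n::finite, 'k::field) qalg pure \<Rightarrow>\<^sub>0 'k" / "\<lambda>u v. u - v \<in> bilinearity"
proof (rule equivpI)
  show "reflp (\<lambda>u v :: ('n, 'k) qalg pure \<Rightarrow>\<^sub>0 'k. u - v \<in> bilinearity)"
    by (simp add: reflp_def bilinearity_0)
  show "symp (\<lambda>u v :: ('n, 'k) qalg pure \<Rightarrow>\<^sub>0 'k. u - v \<in> bilinearity)"
  proof (rule sympI)
    fix p q :: "('n, 'k) qalg pure \<Rightarrow>\<^sub>0 'k"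
    assume "p - q \<in> bilinearity"
    from bilinearity_uminus[OF this] show "q - p \<in> bilinearity" by simp
  qed
  show "transp (\<lambda>u v :: ('n, 'k) qalg pure \<Rightarrow>\<^sub>0 'k. u - v \<in> bilinearity)"
  proof (rule transpI)
    fix p q r :: "('n, 'k) qalg pure \<Rightarrow>\<^sub>0 'k"
    assume "p - q \<in> bilinearity" "q - r \<in> bilinearity"
    from bilinearity_add[OF this] show "p - r \<in> bilinearity" by simp
  qed
qed

text \<open>\<open>augm\<close> is the augmentation \<open>a \<otimes> b \<mapsto> a b\<close>.\<close>

lift_definition augm :: "('n::finite, 'k::field) qenv \<Rightarrow> ('n, 'k) qalg" is
  "linext qscale (\<lambda>p. left p * right p)"
proof -
  fix u v :: "('n, 'k) qalg pure \<Rightarrow>\<^sub>0 'k"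
  assume "u - v \<in> bilinearity"
  let ?e = "linext qscale (\<lambda>p. left p * right p) :: (('n, 'k) qalg pure \<Rightarrow>\<^sub>0 'k) \<Rightarrow> _"
  note m = qalg.module_axioms
  have "?e (u - v) = 0"
    using \<open>u - v \<in> bilinearity\<close> unfolding bilinearity_def
  proof (induction rule: free.span_induct_alt)
    case base
    then show ?case by (simp add: linext_def)
  next
    case (step c x y)
    have "?e x = 0"
      using step(1)
      by (auto simp: linext_diff[OF m] linext_pscale[OF m] linext_single[OF m]
          distrib_left distrib_right qscale_mult_left qscale_mult_right)
    then show ?case using step(2) by (simp add: linext_add[OF m] linext_pscale[OF m])
  qed
  then show "?e u = ?e v" by (simp add: linext_diff[OF m])
qed

instantiation qenv :: (finite, field) comm_ring_1
begin

lift_definition zero_qenv :: "('a, 'b) qenv" is 0 .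
lift_definition one_qenv :: "('a, 'b) qenv" is 1 .
lift_definition plus_qenv :: "('a, 'b) qenv \<Rightarrow> ('a, 'b) qenv \<Rightarrow> ('a, 'b) qenv" is "(+)"
  by (metis add_diff_add bilinearity_add)
lift_definition uminus_qenv :: "('a, 'b) qenv \<Rightarrow> ('a, 'b) qenv" is uminus
  by (metis bilinearity_uminus minus_diff_minus)
lift_definition minus_qenv :: "('a, 'b) qenv \<Rightarrow> ('a, 'b) qenv \<Rightarrow> ('a, 'b) qenv" is "(-)"
proof -
  fix p q r s :: "('a, 'b) qalg pure \<Rightarrow>\<^sub>0 'b"
  assume "p - q \<in> bilinearity" "r - s \<in> bilinearity"
  then have "(p - q) + - (r - s) \<in> bilinearity" by (blast intro: bilinearity_add bilinearity_uminus)
  then show "p - r - (q - s) \<in> bilinearity" by (simp add: algebra_simps)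
qed
lift_definition times_qenv :: "('a, 'b) qenv \<Rightarrow> ('a, 'b) qenv \<Rightarrow> ('a, 'b) qenv" is "(*)"
proof -
  fix p q r s :: "('a, 'b) qalg pure \<Rightarrow>\<^sub>0 'b"
  assume "p - q \<in> bilinearity" "r - s \<in> bilinearity"
  then have "r * (p - q) + q * (r - s) \<in> bilinearity" by (blast intro: bilinearity_add bilinearity_ideal)
  then show "p * r - q * s \<in> bilinearity" by (simp add: algebra_simps)
qed

instance
proof
  have z: "augm (0 :: ('a, 'b) qenv) = 0"
    by transfer (simp add: linext_def)
  have o: "augm (1 :: ('a, 'b) qenv) = 1"
    using linext_single[OF qalg.module_axioms, of "\<lambda>p. left p * right p :: ('a, 'b) qalg" 0 1]
    by (simp add: one_qenv_def augm.abs_eq left_0 right_0)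
  show "(0::('a, 'b) qenv) \<noteq> 1" using z o by (metis zero_neq_one)
qed (transfer; simp add: algebra_simps bilinearity_0)+

end

lift_definition tensor :: "('n::finite, 'k::field) qalg \<Rightarrow> ('n, 'k) qalg \<Rightarrow> ('n, 'k) qenv" (infixl \<open>\<otimes>\<close> 75)
  is "\<lambda>a b. pure_tensor a b" .

text \<open>The action \<open>(a \<otimes> b) c = a c b\<close> of \<open>A\<^sup>e\<close> on \<open>A\<close>; as \<open>A\<close> is commutative, it is
  multiplication with the image under \<open>augm\<close>.\<close>

definition qact :: "('n::finite, 'k::field) qenv \<Rightarrow> ('n, 'k) qalg \<Rightarrow> ('n, 'k) qalg" where
  "qact w c = augm w * c"

lemma augm_tensor: "augm (a \<otimes> b) = a * b"
  by transfer (simp add: linext_single[OF qalg.module_axioms])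

lemma qact_tensor: "qact (a \<otimes> b) c = a * c * b"
  by (simp add: qact_def augm_tensor mult_ac)

lemma augm_add: "augm (v + w) = augm v + augm w"
  by transfer (rule linext_add[OF qalg.module_axioms])

lemma augm_1: "augm 1 = 1"
proof -
  have "(1 :: ('n::finite, 'k::field) qenv) = 1 \<otimes> 1"
    by transfer (simp add: bilinearity_0 flip: zero_pure_def)
  then show ?thesis by (metis augm_tensor mult_1)
qed

lemma augm_mult: "augm (v * w) = augm v * augm w"
proof transfer
  fix v w :: "('n::finite, 'k::field) qalg pure \<Rightarrow>\<^sub>0 'k"
  note m = qalg.module_axioms
  let ?e = "linext qscale (\<lambda>p. left p * right p) :: (('n, 'k) qalg pure \<Rightarrow>\<^sub>0 'k) \<Rightarrow> _"
  have s: "?e (sum f S) = (\<Sum>x\<in>S. ?e (f x))" for f and S :: "('n, 'k) qalg pure set"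
    by (induction S rule: infinite_finite_induct) (auto simp: linext_add[OF m], simp_all add: linext_def)
  have 1: "?e (Poly_Mapping.single p 1 * Poly_Mapping.single q 1) =
      (left p * right p) * (left q * right q)" for p q
    by (simp add: mult_single linext_single[OF m] plus_pure_def ac_simps)
  have 2: "?e (Poly_Mapping.single p 1 * w) = (left p * right p) * ?e w" for p
  proof -
    have "?e (Poly_Mapping.single p 1 * w) = ?e (Poly_Mapping.single p 1 *
        (\<Sum>q\<in>keys w. pscale (lookup w q) (Poly_Mapping.single q 1)))"
      by (simp flip: poly_mapping_as_linext)
    then show ?thesis
      by (simp add: sum_distrib_left s pscale_mult_right linext_pscale[OF m] 1 linext_def[of _ _ w]
          qscale_mult_right)
  qed
  have "?e (v * w) = ?e ((\<Sum>q\<in>keys v. pscale (lookup v q) (Poly_Mapping.single q 1)) * w)"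
    by (simp flip: poly_mapping_as_linext)
  then show "?e (v * w) = ?e v * ?e w"
    by (simp add: sum_distrib_right s pscale_mult_left linext_pscale[OF m] 2 linext_def[of _ _ v] qscale_mult_left)
qed

lemma module_qact: "module (qact :: ('n::finite, 'k::field) qenv \<Rightarrow> _)"
  by standard (auto simp: qact_def augm_add augm_mult augm_1 algebra_simps)

text \<open>The pair \<open>(I, q)\<close> stands for the symbol \<open>e\<^sub>I t\<^sup>(\<^sup>q\<^sup>)\<close>.\<close>

type_synonym 'n sym = "'n set \<times> nat"

definition sym_deg :: "'n sym \<Rightarrow> nat" where
  "sym_deg b = card (fst b) + 2 * snd b"

text \<open>\<open>free_mod m\<close> is the free module on the symbols of degree \<open>m\<close>: it is \<open>F\<^sub>m\<close> for
  coefficients in \<open>A\<^sup>e\<close> and the space with the same basis for coefficients in \<open>k\<close>.\<close>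

definition free_mod :: "nat \<Rightarrow> ('n sym \<Rightarrow>\<^sub>0 'r::zero) set" where
  "free_mod m = {u. \<forall>b\<in>keys u. sym_deg b = m}"

definition sgn_in :: "'n::linorder \<Rightarrow> 'n set \<Rightarrow> 'r::comm_ring_1" where
  "sgn_in i I = (- 1) ^ card {j\<in>I. j < i}"

text \<open>\<open>wedge j I q\<close> is \<open>e\<^sub>j \<and> e\<^sub>I t\<^sup>(\<^sup>q\<^sup>)\<close>, expressed in the basis.\<close>

definition wedge :: "'n::linorder \<Rightarrow> 'n set \<Rightarrow> nat \<Rightarrow> 'n sym \<Rightarrow>\<^sub>0 'r::comm_ring_1" where
  "wedge j I q = (if j \<in> I then 0 else Poly_Mapping.single (insert j I, q) (sgn_in j I))"

text \<open>The sign \<open>(-1)\<^sup>j\<^sup>-\<^sup>1\<close> at the \<open>j\<close>-th element \<open>i\<close> of \<open>I\<close> is \<open>sgn_in i I\<close>.\<close>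

definition d_sym :: "'n::{finite,linorder} sym \<Rightarrow> 'n sym \<Rightarrow>\<^sub>0 ('n, 'k::field) qenv" where
  "d_sym = (\<lambda>(I, q).
     (\<Sum>i\<in>I. pscale (sgn_in i I * (1 \<otimes> qmonom (unit_exp i) - qmonom (unit_exp i) \<otimes> 1))
        (Poly_Mapping.single (I - {i}, q) 1)) +
     (if q = 0 then 0 else
        \<Sum>j\<in>UNIV. pscale ((\<Prod>i | i < j. qmonom (unit_exp i)) \<otimes> (\<Prod>i | j < i. qmonom (unit_exp i)))
          (wedge j I (q - 1))))"

definition diff_F :: "('n::{finite,linorder} sym \<Rightarrow>\<^sub>0 ('n, 'k::field) qenv) \<Rightarrow> 'n sym \<Rightarrow>\<^sub>0 ('n, 'k) qenv" where
  "diff_F = linext pscale d_sym"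

definition Hom_env :: "nat \<Rightarrow> (('n::finite sym \<Rightarrow>\<^sub>0 ('n, 'k::field) qenv) \<Rightarrow> ('n, 'k) qalg) set" where
  "Hom_env m = Hom_on (free_mod m) pscale qact"

definition Hom_k :: "nat \<Rightarrow> (('n::finite sym \<Rightarrow>\<^sub>0 'k::field) \<Rightarrow> ('n, 'k) qalg) set" where
  "Hom_k m = Hom_on (free_mod m) pscale qscale"

text \<open>\<open>base_change\<close> sends every basis element to itself; \<open>restrict_k m\<close> is the isomorphism from
  \<open>Hom_env m\<close> to \<open>Hom_k m\<close>.\<close>

definition base_change :: "('n::finite sym \<Rightarrow>\<^sub>0 'k::field) \<Rightarrow> 'n sym \<Rightarrow>\<^sub>0 ('n, 'k) qenv" where
  "base_change = Poly_Mapping.map (\<lambda>c. qscale c 1 \<otimes> 1)"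

definition restrict_k :: "nat \<Rightarrow> (('n::finite sym \<Rightarrow>\<^sub>0 ('n, 'k::field) qenv) \<Rightarrow> ('n, 'k) qalg) \<Rightarrow>
    ('n sym \<Rightarrow>\<^sub>0 'k) \<Rightarrow> ('n, 'k) qalg" where
  "restrict_k m f = (\<lambda>u. if u \<in> free_mod m then f (base_change u) else 0)"

lemma tensor_zero_left: "0 \<otimes> b = 0"
proof -
  have "pure_tensor (0 + 0) b - pure_tensor 0 b - pure_tensor 0 b \<in> bilinearity"
    unfolding bilinearity_def by (intro free.span_base) blast
  then have "- pure_tensor 0 b \<in> bilinearity" by simp
  from bilinearity_uminus[OF this] show ?thesis
    by (simp add: tensor_def zero_qenv_def qenv.abs_eq_iff)
qed

lemma lookup_base_change: "lookup (base_change u) b = qscale (lookup u b) 1 \<otimes> 1"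
  by (auto simp: base_change_def Poly_Mapping.map.rep_eq when_def tensor_zero_left)

lemma tensor_add_left: "(a + a') \<otimes> b = a \<otimes> b + a' \<otimes> b"
proof transfer
  fix a a' b :: "('n::finite, 'k::field) qalg"
  have "pure_tensor (a + a') b - pure_tensor a b - pure_tensor a' b \<in> bilinearity"
    unfolding bilinearity_def by (intro free.span_base) blast
  then show "pure_tensor (a + a') b - (pure_tensor a b + pure_tensor a' b) \<in> bilinearity"
    by (simp add: algebra_simps)
qed

lemma tensor_mult: "(a \<otimes> b) * (c \<otimes> e) = (a * c) \<otimes> (b * e)"
  by transfer (simp add: mult_single plus_pure_def bilinearity_0)

lemma base_change_add: "base_change (u + v) = base_change u + base_change v"
  by (auto intro!: poly_mapping_eqI
      simp: lookup_base_change lookup_add qalg.scale_left_distrib tensor_add_left)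

lemma base_change_pscale: "base_change (pscale c u) = pscale (qscale c 1 \<otimes> 1) (base_change u)"
  by (auto intro!: poly_mapping_eqI
      simp: lookup_base_change tensor_mult qscale_mult_left)

lemma base_change_free_mod: "u \<in> free_mod m \<Longrightarrow> base_change u \<in> free_mod m"
  by (force simp: free_mod_def in_keys_iff lookup_base_change tensor_zero_left)

lemma free_mod_add: "u \<in> free_mod m \<Longrightarrow> v \<in> free_mod m \<Longrightarrow> u + v \<in> free_mod m"
  using keys_add[of u v] by (fastforce simp: free_mod_def)

lemma free_mod_pscale: "u \<in> free_mod m \<Longrightarrow> pscale c u \<in> free_mod m"
  by (auto simp: free_mod_def in_keys_iff)

lemma linear_on_free_mod:
  fixes f :: "('n::finite sym \<Rightarrow>\<^sub>0 'r::comm_ring_1) \<Rightarrow> 'v::ab_group_add"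
  assumes f: "linear_on (free_mod m) pscale s f" and s: "module s" and u: "u \<in> free_mod m"
  shows "f u = linext s (\<lambda>b. f (Poly_Mapping.single b 1)) u"
proof -
  interpret module s by fact
  have z: "0 \<in> (free_mod m :: ('n sym \<Rightarrow>\<^sub>0 'r) set)" by (simp add: free_mod_def)
  have f0: "f 0 = 0"
    using f z unfolding linear_on_def by (metis add_cancel_left_right)
  have "finite S \<Longrightarrow> S \<subseteq> keys u \<Longrightarrow>
      (\<Sum>b\<in>S. pscale (lookup u b) (Poly_Mapping.single b 1)) \<in> free_mod m \<and>
      f (\<Sum>b\<in>S. pscale (lookup u b) (Poly_Mapping.single b 1)) =
      (\<Sum>b\<in>S. s (lookup u b) (f (Poly_Mapping.single b 1)))" for S
  proof (induction rule: finite_induct)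
    case empty
    then show ?case using f0 z by simp
  next
    case (insert b S)
    have b: "Poly_Mapping.single b 1 \<in> (free_mod m :: ('n sym \<Rightarrow>\<^sub>0 'r) set)"
      using insert.prems u by (auto simp: free_mod_def)
    let ?b = "pscale (lookup u b) (Poly_Mapping.single b 1)"
    let ?S = "\<Sum>b\<in>S. pscale (lookup u b) (Poly_Mapping.single b 1)"
    have S: "?S \<in> free_mod m" "f ?S = (\<Sum>b\<in>S. s (lookup u b) (f (Poly_Mapping.single b 1)))"
      using insert by auto
    have "?b \<in> free_mod m" using b by (rule free_mod_pscale)
    moreover have "f ?b = s (lookup u b) (f (Poly_Mapping.single b 1))"
      using f b unfolding linear_on_def by blast
    moreover have "f (?b + ?S) = f ?b + f ?S"
      using f S(1) \<open>?b \<in> free_mod m\<close> unfolding linear_on_def by blast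
    ultimately show ?case
      using insert.hyps S by (simp add: free_mod_add)
  qed
  from this[of "keys u"] show ?thesis
    by (simp add: linext_def flip: poly_mapping_as_linext)
qed

lemma bij_betw_restrict_k:
  "bij_betw (restrict_k m) (Hom_env m) (Hom_k m :: (('n::finite sym \<Rightarrow>\<^sub>0 'k::field) \<Rightarrow> _) set)"
proof (rule bij_betwI')
  fix f g :: "('n sym \<Rightarrow>\<^sub>0 ('n, 'k) qenv) \<Rightarrow> ('n, 'k) qalg"
  assume f: "f \<in> Hom_env m" and g: "g \<in> Hom_env m"
  show "(restrict_k m f = restrict_k m g) = (f = g)"
  proof
    assume eq: "restrict_k m f = restrict_k m g"
    have b: "f (Poly_Mapping.single b 1) = g (Poly_Mapping.single b 1)" if "sym_deg b = m" for b
    proof -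
      have "base_change (Poly_Mapping.single b 1 :: 'n sym \<Rightarrow>\<^sub>0 'k) = Poly_Mapping.single b 1"
      proof (rule poly_mapping_eqI)
        have 1: "1 \<otimes> 1 = (1 :: ('n, 'k) qenv)"
          by transfer (simp add: bilinearity_0 flip: zero_pure_def)
        show "lookup (base_change (Poly_Mapping.single b 1 :: 'n sym \<Rightarrow>\<^sub>0 'k)) c =
            lookup (Poly_Mapping.single b 1) c" for c
          by (simp add: lookup_base_change lookup_single when_def 1 tensor_zero_left)
      qed
      moreover have "Poly_Mapping.single b 1 \<in> (free_mod m :: ('n sym \<Rightarrow>\<^sub>0 'k) set)"
        using that by (simp add: free_mod_def)
      ultimately show ?thesis
        using fun_cong[OF eq, of "Poly_Mapping.single b 1"] by (simp add: restrict_k_def)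
    qed
    show "f = g"
    proof
      fix u
      show "f u = g u"
      proof (cases "u \<in> free_mod m")
        case True
        then have "f u = linext qact (\<lambda>b. f (Poly_Mapping.single b 1)) u"
          "g u = linext qact (\<lambda>b. g (Poly_Mapping.single b 1)) u"
          using f g linear_on_free_mod[OF _ module_qact] by (auto simp: Hom_env_def Hom_on_def)
        then show ?thesis
          using True b by (auto simp: linext_def free_mod_def intro!: sum.cong)
      next
        case False
        then show ?thesis using f g by (simp add: Hom_env_def Hom_on_def)
      qed
    qed
  qed simp
next
  fix f :: "('n sym \<Rightarrow>\<^sub>0 ('n, 'k) qenv) \<Rightarrow> ('n, 'k) qalg"
  assume f: "f \<in> Hom_env m"
  then show "restrict_k m f \<in> Hom_k m"
    by (auto simp: Hom_env_def Hom_k_def Hom_on_def linear_on_def restrict_k_def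
        base_change_add base_change_pscale base_change_free_mod free_mod_add free_mod_pscale
        qact_def augm_tensor qscale_mult_left)
next
  fix g :: "('n sym \<Rightarrow>\<^sub>0 'k) \<Rightarrow> ('n, 'k) qalg"
  assume g: "g \<in> Hom_k m"
  define f :: "('n sym \<Rightarrow>\<^sub>0 ('n, 'k) qenv) \<Rightarrow> ('n, 'k) qalg" where
    "f = (\<lambda>u. if u \<in> free_mod m then linext qact (\<lambda>b. g (Poly_Mapping.single b 1)) u else 0)"
  have "f \<in> Hom_env m"
    by (auto simp: f_def Hom_env_def Hom_on_def linear_on_def linext_add[OF module_qact]
        linext_pscale[OF module_qact] free_mod_add free_mod_pscale)
  moreover have "g = restrict_k m f"
  proof
    fix u
    show "g u = restrict_k m f u"
    proof (cases "u \<in> free_mod m")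
      case True
      have "keys (base_change u) \<subseteq> keys u"
        by (auto simp: in_keys_iff lookup_base_change tensor_zero_left)
      then have "linext qact (\<lambda>b. g (Poly_Mapping.single b 1)) (base_change u) =
          (\<Sum>b\<in>keys u. qact (qscale (lookup u b) 1 \<otimes> 1) (g (Poly_Mapping.single b 1)))"
        by (simp add: linext_superset[OF module_qact finite_keys] lookup_base_change)
      also have "\<dots> = linext qscale (\<lambda>b. g (Poly_Mapping.single b 1)) u"
        by (simp add: linext_def qact_def augm_tensor qscale_mult_left)
      also have "\<dots> = g u"
        using linear_on_free_mod[OF _ qalg.module_axioms True, of g] g
        by (simp add: Hom_k_def Hom_on_def)
      finally show ?thesis
        using True by (simp add: restrict_k_def f_def base_change_free_mod)
    next
      case False
      then show ?thesis using g by (simp add: restrict_k_def Hom_k_def Hom_on_def)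
    qed
  qed
  ultimately show "\<exists>f\<in>Hom_env m. g = restrict_k m f" by blast
qed

text \<open>\<open>codiff m\<close> is \<open>\<partial>\<^sub>m\<^sub>+\<^sub>1\<close>, that is, with \<open>d\<close> being \<open>diff_F\<close>, \<open>f \<mapsto> f \<circ> d\<^sub>m\<^sub>+\<^sub>1\<close> transported along \<open>restrict_k\<close>.\<close>

definition codiff :: "nat \<Rightarrow> (('n::{finite,linorder} sym \<Rightarrow>\<^sub>0 'k::field) \<Rightarrow> ('n, 'k) qalg) \<Rightarrow>
    ('n sym \<Rightarrow>\<^sub>0 'k) \<Rightarrow> ('n, 'k) qalg" where
  "codiff m g = restrict_k (Suc m)
     (\<lambda>u. if u \<in> free_mod (Suc m) then the_inv_into (Hom_env m) (restrict_k m) g (diff_F u) else 0)"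

definition hscale :: "'k::field \<Rightarrow> ('u \<Rightarrow> ('n::finite, 'k) qalg) \<Rightarrow> 'u \<Rightarrow> ('n, 'k) qalg" where
  "hscale c f = (\<lambda>u. qscale c (f u))"

global_interpretation hom: vector_space "hscale :: 'k::field \<Rightarrow> ('u \<Rightarrow> ('n::finite, 'k) qalg) \<Rightarrow> _"
  by standard (auto simp: hscale_def fun_eq_iff qalg.scale_right_distrib qalg.scale_left_distrib)

definition cochain_complex ::
  "(nat \<Rightarrow> ('u \<Rightarrow> ('n::finite, 'k::field) qalg) set) \<Rightarrow>
   (nat \<Rightarrow> ('u \<Rightarrow> ('n, 'k) qalg) \<Rightarrow> 'u \<Rightarrow> ('n, 'k) qalg) \<Rightarrow> bool" where
  "cochain_complex C \<delta> \<longleftrightarrow> (\<forall>m. hom.subspace (C m) \<and> linear_on (C m) hscale hscale (\<delta> m) \<and>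
     \<delta> m ` C m \<subseteq> C (Suc m) \<and> (\<forall>g\<in>C m. \<delta> (Suc m) (\<delta> m g) = 0))"

definition subcomplex ::
  "(nat \<Rightarrow> ('u \<Rightarrow> ('n::finite, 'k::field) qalg) set) \<Rightarrow> (nat \<Rightarrow> ('u \<Rightarrow> ('n, 'k) qalg) set) \<Rightarrow>
   (nat \<Rightarrow> ('u \<Rightarrow> ('n, 'k) qalg) \<Rightarrow> 'u \<Rightarrow> ('n, 'k) qalg) \<Rightarrow> bool" where
  "subcomplex M C \<delta> \<longleftrightarrow> (\<forall>m. hom.subspace (M m) \<and> M m \<subseteq> C m \<and> \<delta> m ` M m \<subseteq> M (Suc m))"

definition is_direct_sum :: "'v set \<Rightarrow> 'i set \<Rightarrow> ('i \<Rightarrow> 'v::comm_monoid_add set) \<Rightarrow> bool" where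
  "is_direct_sum V J U \<longleftrightarrow> (\<forall>j\<in>J. U j \<subseteq> V) \<and>
     (\<forall>v\<in>V. \<exists>!w. (\<forall>j\<in>J. w j \<in> U j) \<and> (\<forall>j. j \<notin> J \<longrightarrow> w j = 0) \<and>
        finite {j. w j \<noteq> 0} \<and> v = (\<Sum>j | w j \<noteq> 0. w j))"

definition direct_sum_of_subcomplexes ::
  "(nat \<Rightarrow> ('u \<Rightarrow> ('n::finite, 'k::field) qalg) set) \<Rightarrow>
   (nat \<Rightarrow> ('u \<Rightarrow> ('n, 'k) qalg) \<Rightarrow> 'u \<Rightarrow> ('n, 'k) qalg) \<Rightarrow>
   'i set \<Rightarrow> ('i \<Rightarrow> nat \<Rightarrow> ('u \<Rightarrow> ('n, 'k) qalg) set) \<Rightarrow> bool" where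
  "direct_sum_of_subcomplexes C \<delta> J M \<longleftrightarrow>
     (\<forall>j\<in>J. subcomplex (M j) C \<delta>) \<and> (\<forall>m. is_direct_sum (C m) J (\<lambda>j. M j m))"

text \<open>A standard element \<open>(e\<^sub>I t\<^sup>(\<^sup>q\<^sup>), x\<^sup>\<alpha>)\<close> is indexed by \<open>((I, q), \<alpha>)\<close>.\<close>

type_synonym 'n std = "'n sym \<times> ('n \<Rightarrow>\<^sub>0 nat)"

definition std_index :: "'k::field itself \<Rightarrow> 'n::finite std set" where
  "std_index _ = {(b, \<alpha>). \<not> (var_prod :: ('n \<Rightarrow>\<^sub>0 nat) \<Rightarrow>\<^sub>0 'k) dvd monom \<alpha>}"

definition std_deg :: "'n std \<Rightarrow> nat" where
  "std_deg \<gamma> = sym_deg (fst \<gamma>)"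

definition std_elem :: "'n::finite std \<Rightarrow> ('n sym \<Rightarrow>\<^sub>0 'k::field) \<Rightarrow> ('n, 'k) qalg" where
  "std_elem = (\<lambda>(b, \<alpha>) u. if u \<in> free_mod (sym_deg b) then qscale (lookup u b) (qmonom \<alpha>) else 0)"

definition std_basis :: "nat \<Rightarrow> (('n::finite sym \<Rightarrow>\<^sub>0 'k::field) \<Rightarrow> ('n, 'k) qalg) set" where
  "std_basis m = std_elem ` {\<gamma> \<in> std_index TYPE('k). std_deg \<gamma> = m}"

definition Gamma_set :: "'k::field itself \<Rightarrow> 'n::{finite,linorder} std set" where
  "Gamma_set _ = {\<gamma> \<in> std_index TYPE('k). \<forall>m. \<forall>h \<in> codiff m ` Hom_k m.
     hom.representation (std_basis (Suc m)) h (std_elem \<gamma> :: ('n sym \<Rightarrow>\<^sub>0 'k) \<Rightarrow> ('n, 'k) qalg) = 0}"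

definition M_sub :: "'n::{finite,linorder} std \<Rightarrow> nat \<Rightarrow> (('n sym \<Rightarrow>\<^sub>0 'k::field) \<Rightarrow> ('n, 'k) qalg) set" where
  "M_sub = (\<lambda>((I, q), \<alpha>) m.
     if m = card I + 2 * q then hom.span {std_elem ((I, q), \<alpha>)}
     else if m = Suc (card I + 2 * q) then
       hom.span {std_elem ((I - {i}, Suc q), \<alpha> + (\<Sum>j\<in>UNIV - {i}. unit_exp j)) | i. i \<in> I - keys \<alpha>}
     else {0})"

end

(* In the basis of standard elements, the coboundary of (e_I t^(q), x^a) consists of the elements
   (e_(I-{i}) t^(q+1), x^a x_1...x_n/x_i) with i in I and not in supp(x^a). In such an element
   (e_J t^(p), x^b) exactly one exponent b_i vanishes and i is not in J, so i, and with it
   (I, q, a), can be read off. Hence every standard element is a component of the coboundary of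
   at most one standard element, and the latter is not itself a component of a coboundary, since
   i lies in I. The standard elements are thus partitioned into the bases of the M_gamma. *)

theory Submission
  imports Defs
begin

text \<open>The map \<open>codiff\<close> is not given on standard elements: it is precomposition
  with the differential of F, transported through \<open>restrict_k\<close> and its inverse, so its
  formula has to be derived. It is derived in dual form (\<open>hcoef_codiff\<close>), as the
  coordinate of \<open>codiff m g\<close> at a fixed standard element for an arbitrary cochain g.
  This suits \<Gamma>, whose definition quantifies over all coboundaries: at a fixed target the sum
  has at most one term, so nothing can cancel, and "occurs in some coboundary" becomes a condition
  on the index of the target alone. The obstacle is that elements of A are classes of polynomials
  and have no coefficients of their own. Reading a representative only at the exponents outside the
  ideal repairs this. With coordinates available, every subspace in sight is cut out by where
  coordinates may be nonzero, and linear algebra turns into combinatorics of indices.\<close>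

section \<open>Exponent vectors and the ideal generated by the product of all variables\<close>

definition full_exp :: "'n::finite \<Rightarrow>\<^sub>0 nat" where
  "full_exp = (\<Sum>i\<in>UNIV. unit_exp i)"

text \<open>The exponent of x_1...x_n / x_j, the monomial by which the coboundary
  multiplies.\<close>

definition cofull_exp :: "'n::finite \<Rightarrow> 'n \<Rightarrow>\<^sub>0 nat" where
  "cofull_exp j = (\<Sum>i\<in>UNIV - {j}. unit_exp i)"

lemma lookup_full_exp [simp]: "lookup full_exp i = 1"
  by (simp add: full_exp_def lookup_sum unit_exp_def lookup_single when_def)

lemma lookup_cofull_exp [simp]: "lookup (cofull_exp j) i = (if i = j then 0 else 1)"
  by (simp add: cofull_exp_def lookup_sum unit_exp_def lookup_single when_def)

text \<open>Full support is the working form of divisibility by \<open>var_prod\<close>. Support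
  \<open>- {j}\<close> is that of the monomials divisible by x_1...x_n / x_j that survive in
  A.\<close>

lemma keys_eq_UNIV_iff: "keys \<alpha> = UNIV \<longleftrightarrow> (\<forall>i. lookup \<alpha> i \<noteq> 0)"
  by (auto simp: in_keys_iff)

lemma keys_eq_Compl_singleton_iff: "keys \<alpha> = - {j} \<longleftrightarrow> (\<forall>i. lookup \<alpha> i = 0 \<longleftrightarrow> i = j)"
  by (auto simp: in_keys_iff set_eq_iff)

lemma var_prod_eq: "var_prod = Poly_Mapping.single full_exp 1"
  by (simp add: var_prod_def monom_def prod_single full_exp_def)

lemma lookup_single_mult_add:
  fixes p :: "('n \<Rightarrow>\<^sub>0 nat) \<Rightarrow>\<^sub>0 'r::comm_semiring_1"
  shows "lookup (Poly_Mapping.single \<epsilon> c * p) (\<epsilon> + \<alpha>) = c * lookup p \<alpha>"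
  by (simp add: lookup_mult lookup_single when_mult)

lemma lookup_single_mult_nonzeroE:
  fixes p :: "('n \<Rightarrow>\<^sub>0 nat) \<Rightarrow>\<^sub>0 'r::comm_semiring_1"
  assumes "lookup (Poly_Mapping.single \<epsilon> c * p) \<beta> \<noteq> 0"
  obtains \<alpha> where "\<beta> = \<epsilon> + \<alpha>"
  using assms keys_mult[of "Poly_Mapping.single \<epsilon> c" p]
  by (auto simp: in_keys_iff[symmetric] split: if_splits)

text \<open>Subtraction of exponents is truncated at 0, hence the hypothesis.\<close>

lemma exp_add_diff:
  fixes \<beta> :: "'n \<Rightarrow>\<^sub>0 nat"
  assumes "\<And>i. lookup \<epsilon> i \<le> lookup \<beta> i"
  shows "\<beta> = \<epsilon> + (\<beta> - \<epsilon>)"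
  by (rule poly_mapping_eqI) (simp add: lookup_add lookup_minus assms)

lemma lookup_var_prod_multiple:
  assumes "var_prod dvd (p :: ('n::finite \<Rightarrow>\<^sub>0 nat) \<Rightarrow>\<^sub>0 'k::field)" "keys \<alpha> \<noteq> UNIV"
  shows "lookup p \<alpha> = 0"
proof (rule ccontr)
  assume "lookup p \<alpha> \<noteq> 0"
  moreover obtain r where "p = var_prod * r" using assms(1) by (elim dvdE)
  ultimately obtain \<alpha>' where "\<alpha> = full_exp + \<alpha>'"
    unfolding var_prod_eq using lookup_single_mult_nonzeroE by blast
  then show False using assms(2) by (simp add: keys_eq_UNIV_iff lookup_add)
qed

text \<open>Each monomial of p is already a multiple, because its exponent has
  \<open>full_exp\<close> as a summand. With \<open>lookup_var_prod_multiple\<close> this identifies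
  the ideal as the span of the monomials of full support.\<close>

lemma var_prod_dvdI:
  assumes "\<And>\<alpha>. keys \<alpha> \<noteq> UNIV \<Longrightarrow> lookup p \<alpha> = 0"
  shows "var_prod dvd (p :: ('n::finite \<Rightarrow>\<^sub>0 nat) \<Rightarrow>\<^sub>0 'k::field)"
proof -
  have "var_prod dvd pscale (lookup p \<alpha>) (Poly_Mapping.single \<alpha> 1)" if "\<alpha> \<in> keys p" for \<alpha>
  proof -
    have "0 < lookup \<alpha> i" for i
      using assms[of \<alpha>] that by (auto simp: in_keys_iff keys_eq_UNIV_iff intro: gr0I)
    then have "\<alpha> = full_exp + (\<alpha> - full_exp)"
      by (intro exp_add_diff) (simp add: Suc_le_eq)
    then have "pscale (lookup p \<alpha>) (Poly_Mapping.single \<alpha> 1) =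
        var_prod * Poly_Mapping.single (\<alpha> - full_exp) (lookup p \<alpha>)"
      by (simp add: pscale_single var_prod_eq mult_single)
    then show ?thesis by simp
  qed
  then have "var_prod dvd (\<Sum>\<alpha>\<in>keys p. pscale (lookup p \<alpha>) (Poly_Mapping.single \<alpha> 1))"
    by (rule dvd_sum)
  then show ?thesis by (simp flip: poly_mapping_as_linext)
qed

lemma mem_std_index: "(b, \<alpha>) \<in> std_index TYPE('k::field) \<longleftrightarrow> keys \<alpha> \<noteq> UNIV"
proof -
  have "(var_prod :: _ \<Rightarrow>\<^sub>0 'k) dvd monom \<alpha> \<longleftrightarrow> keys \<alpha> = UNIV"
  proof
    assume "(var_prod :: _ \<Rightarrow>\<^sub>0 'k) dvd monom \<alpha>"
    then show "keys \<alpha> = UNIV"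
      using lookup_var_prod_multiple[of "monom \<alpha> :: _ \<Rightarrow>\<^sub>0 'k" \<alpha>] by (auto simp: monom_def)
  next
    assume "keys \<alpha> = UNIV"
    then show "(var_prod :: _ \<Rightarrow>\<^sub>0 'k) dvd monom \<alpha>"
      by (intro var_prod_dvdI) (metis lookup_single_not_eq monom_def)
  qed
  then show ?thesis by (simp add: std_index_def)
qed

section \<open>Coefficients in the quotient algebra A\<close>

text \<open>The exponents divisible by \<open>full_exp\<close> get coefficient \<open>0\<close>, which makes the coefficients
  well defined on the quotient.\<close>

lift_definition qcoef :: "('n::finite, 'k::field) qalg \<Rightarrow> ('n \<Rightarrow>\<^sub>0 nat) \<Rightarrow> 'k" is
  "\<lambda>p \<alpha>. if keys \<alpha> = UNIV then 0 else lookup p \<alpha>"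
proof -
  fix p q :: "('n \<Rightarrow>\<^sub>0 nat) \<Rightarrow>\<^sub>0 'k"
  assume "var_prod dvd p - q"
  from lookup_var_prod_multiple[OF this]
  show "(\<lambda>\<alpha>. if keys \<alpha> = UNIV then 0 else lookup p \<alpha>) =
      (\<lambda>\<alpha>. if keys \<alpha> = UNIV then 0 else lookup q \<alpha>)"
    by (auto simp: lookup_minus)
qed

lemma qcoef_0 [simp]: "qcoef 0 \<alpha> = 0"
  by transfer simp

lemma qcoef_add: "qcoef (a + b) \<alpha> = qcoef a \<alpha> + qcoef b \<alpha>"
  by transfer (simp add: lookup_add)

lemma qcoef_uminus: "qcoef (- a) \<alpha> = - qcoef a \<alpha>"
  by transfer simp

lemma qcoef_qscale: "qcoef (qscale c a) \<alpha> = c * qcoef a \<alpha>"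
  by transfer simp

lemma qcoef_sum: "qcoef (\<Sum>x\<in>S. f x) \<alpha> = (\<Sum>x\<in>S. qcoef (f x) \<alpha>)"
  by (induction S rule: infinite_finite_induct) (auto simp: qcoef_add)

lemma qcoef_full: "keys \<alpha> = UNIV \<Longrightarrow> qcoef a \<alpha> = 0"
  by transfer simp

lemma qcoef_qmonom: "qcoef (qmonom \<alpha>) \<beta> = (if \<alpha> = \<beta> \<and> keys \<alpha> \<noteq> UNIV then 1 else 0)"
  by (simp add: qmonom_def qcoef.abs_eq monom_def lookup_single when_def)

lemma finite_qcoef: "finite {\<alpha>. qcoef a \<alpha> \<noteq> 0}"
proof transfer
  fix p :: "('a \<Rightarrow>\<^sub>0 nat) \<Rightarrow>\<^sub>0 'b"
  have "{\<alpha>. (if keys \<alpha> = UNIV then 0 else lookup p \<alpha>) \<noteq> 0} \<subseteq> keys p"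
    by (auto simp: in_keys_iff)
  then show "finite {\<alpha>. (if keys \<alpha> = UNIV then 0 else lookup p \<alpha>) \<noteq> 0}"
    by (rule finite_subset) simp
qed

text \<open>Injectivity of the coordinates on A: the difference of two representatives has only
  monomials of full support, so it lies in the ideal.\<close>

lemma qcoef_eqI:
  assumes "\<And>\<alpha>. qcoef a \<alpha> = qcoef b \<alpha>"
  shows "a = b"
proof -
  have "\<forall>\<alpha>. qcoef a \<alpha> = qcoef b \<alpha> \<Longrightarrow> a = b"
  proof transfer
    fix p q :: "('a \<Rightarrow>\<^sub>0 nat) \<Rightarrow>\<^sub>0 'b"
    assume "\<forall>\<alpha>. (if keys \<alpha> = UNIV then 0 else lookup p \<alpha>) =
        (if keys \<alpha> = UNIV then 0 else lookup q \<alpha>)"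
    then show "var_prod dvd p - q"
      by (intro var_prod_dvdI) (metis lookup_minus right_minus_eq)
  qed
  then show ?thesis using assms by blast
qed

text \<open>An exponent with summand \<open>cofull_exp j\<close> can vanish only at j. If it does
  not vanish there either, its monomial is 0 in A; so only support \<open>- {j}\<close> can carry a
  coefficient.\<close>

lemma qcoef_cofull_mult:
  assumes "keys \<beta> \<noteq> UNIV"
  shows "qcoef (qmonom (cofull_exp j) * a) \<beta> =
    (if keys \<beta> = - {j} then qcoef a (\<beta> - cofull_exp j) else 0)"
  using assms
proof transfer
  fix \<beta> :: "'a \<Rightarrow>\<^sub>0 nat" and j and p :: "('a \<Rightarrow>\<^sub>0 nat) \<Rightarrow>\<^sub>0 'b"
  assume \<beta>: "keys \<beta> \<noteq> UNIV"
  let ?m = "monom (cofull_exp j) * p"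
  show "(if keys \<beta> = UNIV then 0 else lookup ?m \<beta>) =
    (if keys \<beta> = - {j} then if keys (\<beta> - cofull_exp j) = UNIV then 0 else
       lookup p (\<beta> - cofull_exp j) else 0)"
  proof (cases "keys \<beta> = - {j}")
    case True
    then have l: "lookup \<beta> i = 0 \<longleftrightarrow> i = j" for i
      by (simp add: keys_eq_Compl_singleton_iff)
    then have "\<beta> = cofull_exp j + (\<beta> - cofull_exp j)"
      by (intro exp_add_diff) (auto simp: Suc_le_eq intro: gr0I)
    then have "lookup ?m \<beta> = lookup p (\<beta> - cofull_exp j)"
      unfolding monom_def by (metis lookup_single_mult_add mult_1)
    \<comment> \<open>The exponent at j stays 0, so \<open>qcoef\<close> does not cut off this
      coefficient of p.\<close>
    moreover have "keys (\<beta> - cofull_exp j) \<noteq> UNIV"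
      using l[of j] by (auto simp: keys_eq_UNIV_iff lookup_minus)
    ultimately show ?thesis using True \<beta> by simp
  next
    case False
    have "lookup ?m \<beta> = 0"
    proof (rule ccontr)
      assume "lookup ?m \<beta> \<noteq> 0"
      then obtain \<alpha> where "\<beta> = cofull_exp j + \<alpha>"
        unfolding monom_def by (rule lookup_single_mult_nonzeroE)
      then have "lookup \<beta> i = 0 \<Longrightarrow> i = j" for i
        by (auto simp: lookup_add split: if_splits)
      then have "keys \<beta> = UNIV \<or> keys \<beta> = - {j}"
        unfolding keys_eq_UNIV_iff keys_eq_Compl_singleton_iff by metis
      then show False using \<beta> False by simp
    qed
    then show ?thesis using False by simp
  qed
qed

lemma qmonom_0: "qmonom 0 = 1"
  by transfer (simp add: monom_def)

lemma qmonom_mult: "qmonom \<alpha> * qmonom \<beta> = qmonom (\<alpha> + \<beta>)"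
  by transfer (simp add: monom_def mult_single)

lemma prod_qmonom: "(\<Prod>i\<in>S. qmonom (f i)) = qmonom (\<Sum>i\<in>S. f i)"
  by (induction S rule: infinite_finite_induct) (auto simp: qmonom_mult qmonom_0)

section \<open>Coordinates with respect to the standard elements\<close>

text \<open>Defined for every function and every index, without reference to a degree: elements of
  \<open>Hom_k m\<close> are extended by zero, so their coordinates at symbols of other degrees are
  0 automatically.\<close>

definition hcoef :: "(('n::finite sym \<Rightarrow>\<^sub>0 'k::field) \<Rightarrow> ('n, 'k) qalg) \<Rightarrow> 'n std \<Rightarrow> 'k" where
  "hcoef f = (\<lambda>(b, \<alpha>). qcoef (f (Poly_Mapping.single b 1)) \<alpha>)"

lemma hcoef_0 [simp]: "hcoef 0 \<gamma> = 0"
  by (simp add: hcoef_def split: prod.split)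

lemma hcoef_add: "hcoef (f + g) \<gamma> = hcoef f \<gamma> + hcoef g \<gamma>"
  by (simp add: hcoef_def qcoef_add split: prod.split)

lemma hcoef_hscale: "hcoef (hscale c f) \<gamma> = c * hcoef f \<gamma>"
  by (simp add: hcoef_def hscale_def qcoef_qscale split: prod.split)

lemma hcoef_sum: "hcoef (\<Sum>x\<in>S. f x) \<gamma> = (\<Sum>x\<in>S. hcoef (f x) \<gamma>)"
  by (induction S rule: infinite_finite_induct) (simp_all add: hcoef_add del: zero_fun_apply plus_fun_apply)

lemma zero_free_mod: "0 \<in> free_mod m"
  by (simp add: free_mod_def)

lemma single_free_mod: "sym_deg b = m \<Longrightarrow> Poly_Mapping.single b c \<in> free_mod m"
  by (simp add: free_mod_def)

lemma Hom_k_outside: "f \<in> Hom_k m \<Longrightarrow> u \<notin> free_mod m \<Longrightarrow> f u = 0"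
  by (simp add: Hom_k_def Hom_on_def)

lemma subspace_Hom_k: "hom.subspace (Hom_k m)"
  by (rule hom.subspaceI)
    (auto simp: Hom_k_def Hom_on_def linear_on_def hscale_def qalg.scale_right_distrib
      qalg.scale_left_commute algebra_simps)

lemma hcoef_support:
  fixes f :: "('n::finite sym \<Rightarrow>\<^sub>0 'k::field) \<Rightarrow> ('n, 'k) qalg"
  assumes "f \<in> Hom_k m" "hcoef f \<gamma> \<noteq> 0"
  shows "\<gamma> \<in> std_index TYPE('k)" "std_deg \<gamma> = m"
proof -
  obtain b \<alpha> where \<gamma>: "\<gamma> = (b, \<alpha>)" by (cases \<gamma>)
  show "\<gamma> \<in> std_index TYPE('k)"
    using assms(2) by (auto simp: \<gamma> mem_std_index hcoef_def qcoef_full)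
  show "std_deg \<gamma> = m"
  proof (rule ccontr)
    assume "std_deg \<gamma> \<noteq> m"
    then have "(Poly_Mapping.single b 1 :: 'n sym \<Rightarrow>\<^sub>0 'k) \<notin> free_mod m"
      by (simp add: \<gamma> std_deg_def free_mod_def)
    then show False using assms by (simp add: \<gamma> hcoef_def Hom_k_outside)
  qed
qed

text \<open>Only finitely many symbols have degree m, since \<open>'n\<close> is finite and |I| + 2q
  = m bounds q; the value at each of them has finitely many coefficients.\<close>

lemma finite_hcoef:
  fixes f :: "('n::finite sym \<Rightarrow>\<^sub>0 'k::field) \<Rightarrow> ('n, 'k) qalg"
  assumes "f \<in> Hom_k m"
  shows "finite {\<gamma>. hcoef f \<gamma> \<noteq> 0}"
proof (rule finite_subset)
  let ?B = "UNIV \<times> {..m} :: 'n sym set"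
  show "{\<gamma>. hcoef f \<gamma> \<noteq> 0} \<subseteq>
      Sigma ?B (\<lambda>b. {\<alpha>. qcoef (f (Poly_Mapping.single b 1)) \<alpha> \<noteq> 0})"
    using hcoef_support(2)[OF assms] by (force simp: hcoef_def std_deg_def sym_deg_def)
  show "finite (Sigma ?B (\<lambda>b. {\<alpha>. qcoef (f (Poly_Mapping.single b 1)) \<alpha> \<noteq> 0}))"
    by (intro finite_SigmaI finite_qcoef) (auto intro: finite_cartesian_product)
qed

lemma hcoef_eqI:
  assumes f: "f \<in> Hom_k m" and g: "g \<in> Hom_k m" and eq: "\<And>\<gamma>. hcoef f \<gamma> = hcoef g \<gamma>"
  shows "f = g"
proof
  fix u
  have single: "f (Poly_Mapping.single b 1) = g (Poly_Mapping.single b 1)" for b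
    using eq[of "(b, _)"] by (auto simp: hcoef_def intro: qcoef_eqI)
  have expand: "h u = linext qscale (\<lambda>b. h (Poly_Mapping.single b 1)) u"
    if "h \<in> Hom_k m" "u \<in> free_mod m" for h :: "('a sym \<Rightarrow>\<^sub>0 'b) \<Rightarrow> ('a, 'b) qalg"
    using linear_on_free_mod[OF _ qalg.module_axioms that(2), of h] that(1)
    by (simp add: Hom_k_def Hom_on_def)
  show "f u = g u"
  proof (cases "u \<in> free_mod m")
    case True
    show ?thesis by (simp only: expand[OF f True] expand[OF g True] single)
  qed (use f g in \<open>simp add: Hom_k_outside\<close>)
qed

lemma std_elem_Hom_k: "std_deg \<gamma> = m \<Longrightarrow> std_elem \<gamma> \<in> Hom_k m"
  by (cases \<gamma>) (auto simp: Hom_k_def Hom_on_def std_elem_def std_deg_def linear_on_def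
      free_mod_add free_mod_pscale lookup_add qalg.scale_left_distrib)

lemma hcoef_std_elem:
  fixes \<gamma> :: "'n::finite std"
  assumes "\<gamma> \<in> std_index TYPE('k)"
  shows "hcoef (std_elem \<gamma> :: ('n sym \<Rightarrow>\<^sub>0 'k::field) \<Rightarrow> ('n, 'k) qalg) \<delta> = (if \<delta> = \<gamma> then 1 else 0)"
proof -
  obtain b \<alpha> c \<beta> where [simp]: "\<gamma> = (b, \<alpha>)" "\<delta> = (c, \<beta>)" by (cases \<gamma>, cases \<delta>)
  have "keys \<alpha> \<noteq> UNIV" using assms by (simp add: mem_std_index)
  then show ?thesis
    by (auto simp: hcoef_def std_elem_def free_mod_def qcoef_qscale qcoef_qmonom lookup_single when_def)
qed

lemma inj_on_std_elem:
  "inj_on (std_elem :: 'n::finite std \<Rightarrow> ('n sym \<Rightarrow>\<^sub>0 'k::field) \<Rightarrow> ('n, 'k) qalg)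
     (std_index TYPE('k))"
proof (rule inj_onI)
  fix \<gamma> \<delta> :: "'n std"
  let ?s = "std_elem :: 'n std \<Rightarrow> ('n sym \<Rightarrow>\<^sub>0 'k) \<Rightarrow> ('n, 'k) qalg"
  assume "\<gamma> \<in> std_index TYPE('k)" "\<delta> \<in> std_index TYPE('k)" "?s \<gamma> = ?s \<delta>"
  then show "\<gamma> = \<delta>"
    by (metis hcoef_std_elem zero_neq_one)
qed

lemma hcoef_expansion:
  assumes f: "f \<in> Hom_k m"
  shows "f = (\<Sum>\<gamma> | hcoef f \<gamma> \<noteq> 0. hscale (hcoef f \<gamma>) (std_elem \<gamma>))"
proof (rule hcoef_eqI[OF f])
  show "(\<Sum>\<gamma> | hcoef f \<gamma> \<noteq> 0. hscale (hcoef f \<gamma>) (std_elem \<gamma>)) \<in> Hom_k m"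
    by (intro hom.subspace_sum[OF subspace_Hom_k] hom.subspace_scale[OF subspace_Hom_k]
        std_elem_Hom_k) (simp add: hcoef_support(2)[OF f])
  fix \<delta>
  have "hcoef (\<Sum>\<gamma> | hcoef f \<gamma> \<noteq> 0. hscale (hcoef f \<gamma>) (std_elem \<gamma>)) \<delta> =
      (\<Sum>\<gamma> | hcoef f \<gamma> \<noteq> 0. if \<delta> = \<gamma> then hcoef f \<gamma> else 0)"
    using hcoef_support(1)[OF f]
    by (auto simp: hcoef_sum hcoef_hscale hcoef_std_elem intro!: sum.cong)
  then show "hcoef f \<delta> = hcoef (\<Sum>\<gamma> | hcoef f \<gamma> \<noteq> 0. hscale (hcoef f \<gamma>) (std_elem \<gamma>)) \<delta>"
    using finite_hcoef[OF f] by (simp add: sum.delta')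
qed

text \<open>The bridge from linear algebra to index sets: spans of standard elements are handled
  from here on through the supports of coordinate functions.\<close>

lemma mem_span_std_elem_iff:
  fixes f :: "('n::finite sym \<Rightarrow>\<^sub>0 'k::field) \<Rightarrow> ('n, 'k) qalg"
  assumes S: "S \<subseteq> {\<gamma> \<in> std_index TYPE('k). std_deg \<gamma> = m}"
  shows "f \<in> hom.span (std_elem ` S) \<longleftrightarrow> f \<in> Hom_k m \<and> (\<forall>\<gamma>. hcoef f \<gamma> \<noteq> 0 \<longrightarrow> \<gamma> \<in> S)"
proof
  assume "f \<in> hom.span (std_elem ` S)"
  then show "f \<in> Hom_k m \<and> (\<forall>\<gamma>. hcoef f \<gamma> \<noteq> 0 \<longrightarrow> \<gamma> \<in> S)"
  proof (induction rule: hom.span_induct_alt)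
    case base
    then show ?case using hom.subspace_0[OF subspace_Hom_k] by (metis hcoef_0)
  next
    case (step c x y)
    then obtain \<gamma> where \<gamma>: "\<gamma> \<in> S" "x = std_elem \<gamma>" by blast
    then have "x \<in> Hom_k m" using S std_elem_Hom_k by blast
    moreover have "hcoef x \<delta> = (if \<delta> = \<gamma> then 1 else 0)" for \<delta>
      using S \<gamma> by (auto simp: hcoef_std_elem)
    ultimately show ?case
      using step(2) \<gamma>(1)
      by (auto simp: hcoef_add hcoef_hscale simp del: plus_fun_apply split: if_splits
          intro: hom.subspace_add[OF subspace_Hom_k] hom.subspace_scale[OF subspace_Hom_k])
  qed
next
  assume f: "f \<in> Hom_k m \<and> (\<forall>\<gamma>. hcoef f \<gamma> \<noteq> 0 \<longrightarrow> \<gamma> \<in> S)"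
  then have "(\<Sum>\<gamma> | hcoef f \<gamma> \<noteq> 0. hscale (hcoef f \<gamma>) (std_elem \<gamma>)) \<in> hom.span (std_elem ` S)"
    by (intro hom.span_sum hom.span_scale hom.span_base) auto
  then show "f \<in> hom.span (std_elem ` S)"
    by (subst hcoef_expansion[of f m]) (use f in blast)+
qed

lemma span_std_basis: "hom.span (std_basis m) = Hom_k m"
proof -
  have "f \<in> hom.span (std_basis m) \<longleftrightarrow> f \<in> Hom_k m" for f :: "('a sym \<Rightarrow>\<^sub>0 'b) \<Rightarrow> ('a, 'b) qalg"
    unfolding std_basis_def using hcoef_support[of f m]
    by (subst mem_span_std_elem_iff[where m = m]) auto
  then show ?thesis by blast
qed

lemma independent_std_basis:
  "hom.independent (std_basis m :: (('n::finite sym \<Rightarrow>\<^sub>0 'k::field) \<Rightarrow> ('n, 'k) qalg) set)"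
  unfolding hom.dependent_def
proof (rule notI, elim bexE)
  let ?s = "std_elem :: 'n std \<Rightarrow> ('n sym \<Rightarrow>\<^sub>0 'k) \<Rightarrow> ('n, 'k) qalg"
  let ?I = "{\<gamma> \<in> std_index TYPE('k). std_deg \<gamma> = m} :: 'n std set"
  fix f :: "('n sym \<Rightarrow>\<^sub>0 'k) \<Rightarrow> ('n, 'k) qalg"
  assume f: "f \<in> std_basis m" "f \<in> hom.span (std_basis m - {f})"
  then obtain \<gamma> where \<gamma>: "\<gamma> \<in> ?I" "f = ?s \<gamma>" by (auto simp: std_basis_def)
  have "std_basis m - {f} \<subseteq> ?s ` (?I - {\<gamma>})"
    using \<gamma> by (auto simp: std_basis_def)
  then have "f \<in> hom.span (?s ` (?I - {\<gamma>}))"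
    using f(2) hom.span_mono by blast
  then have "hcoef f \<gamma> = 0"
    using mem_span_std_elem_iff[of "?I - {\<gamma>}" m f] by blast
  then show False using \<gamma> by (simp add: hcoef_std_elem)
qed

text \<open>Connects the definition of \<Gamma>, phrased with \<open>hom.representation\<close>, to
  \<open>hcoef\<close>. For \<gamma> of another degree both sides are 0, as
  \<open>hom.representation\<close> vanishes off the basis.\<close>

lemma representation_std_basis:
  fixes h :: "('n::finite sym \<Rightarrow>\<^sub>0 'k::field) \<Rightarrow> ('n, 'k) qalg"
  assumes h: "h \<in> Hom_k m" and \<gamma>: "\<gamma> \<in> std_index TYPE('k)"
  shows "hom.representation (std_basis m) h (std_elem \<gamma>) = hcoef h \<gamma>"
proof (cases "std_deg \<gamma> = m")
  case True
  let ?B = "std_basis m :: (('n sym \<Rightarrow>\<^sub>0 'k) \<Rightarrow> ('n, 'k) qalg) set"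
  let ?r = "hom.representation ?B h"
  have fin: "finite {b. ?r b \<noteq> 0}" by (rule hom.finite_representation)
  have "h = (\<Sum>b | ?r b \<noteq> 0. hscale (?r b) b)"
    using hom.sum_nonzero_representation_eq[OF independent_std_basis, of h m] h
    by (simp add: span_std_basis)
  then have "hcoef h \<gamma> = (\<Sum>b | ?r b \<noteq> 0. ?r b * hcoef b \<gamma>)"
    by (metis (no_types, lifting) hcoef_hscale hcoef_sum sum.cong)
  also have "\<dots> = (\<Sum>b | ?r b \<noteq> 0. if b = std_elem \<gamma> then ?r b else 0)"
  proof (rule sum.cong)
    fix b assume "b \<in> {b. ?r b \<noteq> 0}"
    then have "b \<in> ?B" by (auto dest: hom.representation_ne_zero)
    then obtain \<delta> where \<delta>: "\<delta> \<in> std_index TYPE('k)" "b = std_elem \<delta>"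
      by (auto simp: std_basis_def)
    \<comment> \<open>The right-hand side compares elements, \<open>hcoef_std_elem\<close> compares
      indices; injectivity of \<open>std_elem\<close> ties the two together.\<close>
    then show "?r b * hcoef b \<gamma> = (if b = std_elem \<gamma> then ?r b else 0)"
      using inj_onD[OF inj_on_std_elem _ \<delta>(1) \<gamma>] by (auto simp: hcoef_std_elem)
  qed simp
  also have "\<dots> = ?r (std_elem \<gamma>)"
    using fin by (auto simp: sum.delta)
  finally show ?thesis by simp
next
  case False
  have "std_elem \<gamma> \<notin> (std_basis m :: (('n sym \<Rightarrow>\<^sub>0 'k) \<Rightarrow> ('n, 'k) qalg) set)"
    using False inj_onD[OF inj_on_std_elem[where 'k = 'k] _ \<gamma>] by (auto simp: std_basis_def)
  then have "hom.representation (std_basis m) h (std_elem \<gamma>) = 0"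
    using hom.representation_ne_zero by blast
  then show ?thesis using False hcoef_support(2)[OF h] by metis
qed

section \<open>The coboundary in coordinates\<close>

lemma linext_sum:
  assumes "module s"
  shows "linext s f (\<Sum>x\<in>S. g x) = (\<Sum>x\<in>S. linext s f (g x))"
proof -
  have "linext s f 0 = 0" by (simp add: linext_def)
  then show ?thesis
    by (induction S rule: infinite_finite_induct) (auto simp: linext_add[OF assms])
qed

lemma free_mod_sum: "(\<And>x. x \<in> S \<Longrightarrow> f x \<in> free_mod m) \<Longrightarrow> sum f S \<in> free_mod m"
  by (induction S rule: infinite_finite_induct) (auto simp: zero_free_mod free_mod_add)

lemma d_sym_free_mod:
  assumes "sym_deg b = Suc m"
  shows "d_sym b \<in> free_mod m"
proof -
  obtain I q where [simp]: "b = (I, q)" by (cases b)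
  have deg: "card I + 2 * q = Suc m" using assms by (simp add: sym_deg_def)
  have "sym_deg (I - {i}, q) = m" if "i \<in> I" for i
    using deg that card_Suc_Diff1[of I i] by (simp add: sym_deg_def)
  moreover have "sym_deg (insert j I, q - 1) = m" if "q \<noteq> 0" "j \<notin> I" for j
    using deg that by (simp add: sym_deg_def)
  ultimately show ?thesis
    by (auto simp: d_sym_def wedge_def zero_free_mod
        intro!: free_mod_add free_mod_sum free_mod_pscale single_free_mod)
qed

lemma diff_F_free_mod:
  assumes "u \<in> free_mod (Suc m)"
  shows "diff_F u \<in> free_mod m"
  unfolding diff_F_def linext_def
  by (intro free_mod_sum free_mod_pscale d_sym_free_mod) (use assms in \<open>auto simp: free_mod_def\<close>)

lemma diff_F_add: "diff_F (u + v) = diff_F u + diff_F v"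
  by (simp add: diff_F_def linext_add[OF free.module_axioms])

lemma diff_F_pscale: "diff_F (pscale c u) = pscale c (diff_F u)"
  by (simp add: diff_F_def linext_pscale[OF free.module_axioms])

lemma one_tensor_one: "1 \<otimes> 1 = 1"
  by transfer (simp add: bilinearity_0 flip: zero_pure_def)

lemma base_change_single: "base_change (Poly_Mapping.single b 1) = Poly_Mapping.single b 1"
  by (rule poly_mapping_eqI)
    (simp add: lookup_base_change lookup_single when_def one_tensor_one tensor_zero_left)

lemma augm_uminus: "augm (- v) = - augm v"
proof -
  have "augm (0 :: ('a, 'b) qenv) = 0" using augm_add[of 0 0] by simp
  then show ?thesis using augm_add[of v "- v"] by (simp add: eq_neg_iff_add_eq_0 add.commute)
qed

lemma augm_power: "augm (v ^ n) = augm v ^ n"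
  by (induction n) (simp_all add: augm_1 augm_mult)

lemma augm_sgn_in: "augm (sgn_in i I) = sgn_in i I"
  by (simp add: sgn_in_def augm_power augm_uminus augm_1)

text \<open>Hides the inverse of \<open>restrict_k\<close> behind an \<open>f\<close> of which only
  linearity over the enveloping algebra and the values on basis symbols are kept; these determine
  it.\<close>

lemma codiff_transport:
  fixes g :: "('n::{finite,linorder} sym \<Rightarrow>\<^sub>0 'k::field) \<Rightarrow> ('n, 'k) qalg"
  assumes g: "g \<in> Hom_k m"
  obtains f where "f \<in> Hom_env m"
    "\<forall>b. sym_deg b = m \<longrightarrow> f (Poly_Mapping.single b 1) = g (Poly_Mapping.single b 1)"
    "codiff m g = restrict_k (Suc m) (\<lambda>u. if u \<in> free_mod (Suc m) then f (diff_F u) else 0)"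
proof
  let ?f = "the_inv_into (Hom_env m) (restrict_k m) g"
  note bij = bij_betw_restrict_k[where m = m and 'n = 'n and 'k = 'k]
  show "?f \<in> Hom_env m"
    using bij g by (metis bij_betw_def order_refl the_inv_into_into)
  have r: "restrict_k m ?f = g"
    using bij g by (metis f_the_inv_into_f_bij_betw)
  have "?f (Poly_Mapping.single b 1) = g (Poly_Mapping.single b 1)" if "sym_deg b = m" for b
    using fun_cong[OF r, of "Poly_Mapping.single b 1"] that
    by (simp add: restrict_k_def single_free_mod base_change_single)
  then show "\<forall>b. sym_deg b = m \<longrightarrow> ?f (Poly_Mapping.single b 1) = g (Poly_Mapping.single b 1)"
    by blast
  show "codiff m g = restrict_k (Suc m) (\<lambda>u. if u \<in> free_mod (Suc m) then ?f (diff_F u) else 0)"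
    by (simp add: codiff_def)
qed

lemma codiff_Hom_k:
  fixes g :: "('n::{finite,linorder} sym \<Rightarrow>\<^sub>0 'k::field) \<Rightarrow> ('n, 'k) qalg"
  assumes g: "g \<in> Hom_k m"
  shows "codiff m g \<in> Hom_k (Suc m)"
proof -
  obtain f where f: "f \<in> Hom_env m"
    "\<forall>b. sym_deg b = m \<longrightarrow> f (Poly_Mapping.single b 1) = g (Poly_Mapping.single b 1)"
    "codiff m g = restrict_k (Suc m) (\<lambda>u. if u \<in> free_mod (Suc m) then f (diff_F u) else 0)"
    by (rule codiff_transport[OF g])
  have "(\<lambda>u. if u \<in> free_mod (Suc m) then f (diff_F u) else 0) \<in> Hom_env (Suc m)"
    using f(1)
    by (simp add: Hom_env_def Hom_on_def linear_on_def free_mod_add free_mod_pscale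
        diff_F_add diff_F_pscale diff_F_free_mod)
  then show ?thesis
    unfolding f(3) using bij_betw_restrict_k bij_betwE by blast
qed

text \<open>The first sum of the differential disappears since \<open>1 \<otimes> x\<^sub>i - x\<^sub>i \<otimes> 1\<close> acts as \<open>0\<close> on \<open>A\<close>.\<close>

lemma codiff_single:
  fixes g :: "('n::{finite,linorder} sym \<Rightarrow>\<^sub>0 'k::field) \<Rightarrow> ('n, 'k) qalg"
  assumes g: "g \<in> Hom_k m" and deg: "sym_deg (J, p) = Suc m"
  shows "codiff m g (Poly_Mapping.single (J, p) 1) =
    (if p = 0 then 0 else \<Sum>j\<in>- J. sgn_in j J *
       (qmonom (cofull_exp j) * g (Poly_Mapping.single (insert j J, p - 1) 1)))"
proof -
  obtain f where f: "f \<in> Hom_env m"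
    "\<forall>b. sym_deg b = m \<longrightarrow> f (Poly_Mapping.single b 1) = g (Poly_Mapping.single b 1)"
    "codiff m g = restrict_k (Suc m) (\<lambda>u. if u \<in> free_mod (Suc m) then f (diff_F u) else 0)"
    by (rule codiff_transport[OF g])
  let ?e = "linext qact (\<lambda>b. f (Poly_Mapping.single b 1))"
  let ?v = "(\<lambda>j. (\<Prod>i | i < j. qmonom (unit_exp i)) \<otimes> (\<Prod>i | j < i. qmonom (unit_exp i)))
      :: 'n \<Rightarrow> ('n, 'k) qenv"
  note m = module_qact
  \<comment> \<open>Multiplying the two tensor factors gives the product over all indices except j,
    because the order on \<open>'n\<close> is linear.\<close>
  have v: "augm (?v j) = qmonom (cofull_exp j)" for j :: 'n
  proof -
    have "augm (?v j) = (\<Prod>i\<in>{i. i < j} \<union> {i. j < i}. qmonom (unit_exp i))"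
      by (subst prod.union_disjoint) (auto simp: augm_tensor)
    also have "{i. i < j} \<union> {i. j < i} = UNIV - {j}" by auto
    finally show ?thesis by (simp add: prod_qmonom cofull_exp_def)
  qed
  have first: "augm (sgn_in i J * (1 \<otimes> qmonom (unit_exp i) - qmonom (unit_exp i) \<otimes> 1)) =
      (0 :: ('n, 'k) qalg)" for i :: 'n
    using augm_add[of "1 \<otimes> qmonom (unit_exp i)" "- (qmonom (unit_exp i) \<otimes> 1) :: ('n, 'k) qenv"]
    by (simp add: augm_mult augm_uminus augm_tensor)
  have wedge: "?e (wedge j J (p - 1)) =
      (if j \<in> J then 0 else sgn_in j J * f (Poly_Mapping.single (insert j J, p - 1) 1))" for j
    by (simp add: wedge_def linext_single[OF m] qact_def augm_sgn_in) (simp add: linext_def)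
  have degj: "sym_deg (insert j J, p - 1) = m" if "p \<noteq> 0" "j \<notin> J" for j
    using deg that by (simp add: sym_deg_def)
  have "codiff m g (Poly_Mapping.single (J, p) 1) = f (diff_F (Poly_Mapping.single (J, p) 1))"
    using deg by (simp add: f(3) restrict_k_def single_free_mod base_change_single)
  also have "\<dots> = f (d_sym (J, p))"
    by (simp add: diff_F_def linext_single[OF free.module_axioms])
  also have "\<dots> = ?e (d_sym (J, p))"
    using linear_on_free_mod[OF _ m d_sym_free_mod[OF deg], of f] f(1)
    by (simp add: Hom_env_def Hom_on_def)
  also have "\<dots> = ?e (if p = 0 then 0 else \<Sum>j\<in>UNIV. pscale (?v j) (wedge j J (p - 1)))"
    by (simp add: d_sym_def linext_add[OF m] linext_sum[OF m] linext_pscale[OF m] qact_def first)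
  also have "\<dots> = (if p = 0 then 0 else \<Sum>j\<in>UNIV. qmonom (cofull_exp j) * ?e (wedge j J (p - 1)))"
    by (simp add: linext_sum[OF m] linext_pscale[OF m] qact_def[of "?v _"] v) (simp add: linext_def)
  also have "\<dots> = (if p = 0 then 0 else \<Sum>j\<in>- J. sgn_in j J *
       (qmonom (cofull_exp j) * g (Poly_Mapping.single (insert j J, p - 1) 1)))"
    unfolding wedge using degj
    by (auto simp: f(2) mult_ac intro!: sum.mono_neutral_cong_right)
  finally show ?thesis .
qed

text \<open>The sign is read in A on the left and in k on the right; the parity of its exponent
  decides both.\<close>

lemma qcoef_sgn_in_mult: "qcoef (sgn_in j J * a) \<alpha> = sgn_in j J * qcoef a \<alpha>"
  by (cases "even (card {i \<in> J. i < j})") (simp_all add: sgn_in_def qcoef_uminus)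

text \<open>The formula for the coboundary seen from the target. As
  \<open>keys \<beta> = - {j}\<close> determines j, the index set of the sum has at most one
  element.\<close>

lemma hcoef_codiff:
  fixes g :: "('n::{finite,linorder} sym \<Rightarrow>\<^sub>0 'k::field) \<Rightarrow> ('n, 'k) qalg"
  assumes g: "g \<in> Hom_k m"
  shows "hcoef (codiff m g) ((J, p), \<beta>) =
    (if p = 0 then 0 else \<Sum>j | j \<notin> J \<and> keys \<beta> = - {j}.
       sgn_in j J * hcoef g ((insert j J, p - 1), \<beta> - cofull_exp j))"
proof (cases "sym_deg (J, p) = Suc m \<and> keys \<beta> \<noteq> UNIV")
  case True
  have "(\<Sum>j\<in>- J. sgn_in j J *
      qcoef (qmonom (cofull_exp j) * g (Poly_Mapping.single (insert j J, p - 1) 1)) \<beta>) =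
      (\<Sum>j | j \<notin> J \<and> keys \<beta> = - {j}.
         sgn_in j J * hcoef g ((insert j J, p - 1), \<beta> - cofull_exp j))"
    using True
    by (intro sum.mono_neutral_cong_right) (auto simp: qcoef_cofull_mult hcoef_def)
  then show ?thesis
    using True by (simp add: hcoef_def codiff_single[OF g] qcoef_sum qcoef_sgn_in_mult)
next
  case False
  \<comment> \<open>If the target has the wrong degree, then so has its predecessor, since |J| + 1 +
    2(p - 1) = |J| + 2p - 1; if \<beta> has full support, no j qualifies.\<close>
  have "hcoef g ((insert j J, p - 1), \<beta> - cofull_exp j) = 0"
    if "p \<noteq> 0" "j \<notin> J" "keys \<beta> = - {j}" for j
  proof (rule ccontr)
    assume "hcoef g ((insert j J, p - 1), \<beta> - cofull_exp j) \<noteq> 0"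
    from hcoef_support(2)[OF g this] have "sym_deg (J, p) = Suc m"
      using that by (simp add: std_deg_def sym_deg_def)
    then show False using False that by auto
  qed
  moreover have "hcoef (codiff m g) ((J, p), \<beta>) = 0"
    using False hcoef_support[OF codiff_Hom_k[OF g], of "((J, p), \<beta>)"]
    by (auto simp: mem_std_index std_deg_def)
  ultimately show ?thesis by (auto intro!: sum.neutral)
qed

lemma codiff_support:
  assumes g: "g \<in> Hom_k m" and "hcoef (codiff m g) ((J, p), \<beta>) \<noteq> 0"
  obtains j where "p \<noteq> 0" "j \<notin> J" "keys \<beta> = - {j}"
    "hcoef g ((insert j J, p - 1), \<beta> - cofull_exp j) \<noteq> 0"
proof -
  have p: "p \<noteq> 0" and "(\<Sum>j | j \<notin> J \<and> keys \<beta> = - {j}.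
      sgn_in j J * hcoef g ((insert j J, p - 1), \<beta> - cofull_exp j)) \<noteq> 0"
    using assms by (auto simp: hcoef_codiff split: if_splits)
  then obtain j where "j \<notin> J \<and> keys \<beta> = - {j}"
      "hcoef g ((insert j J, p - 1), \<beta> - cofull_exp j) \<noteq> 0"
    by (metis (mono_tags, lifting) mem_Collect_eq mult_zero_right sum.neutral)
  then show thesis using that p by blast
qed

section \<open>The cochain complex\<close>

text \<open>In the square of the coboundary there is nothing to cancel. Going back once from a
  target puts j into the index set and leaves the exponent at j equal to 0; going back again would
  need the only zero of the exponent to lie outside that index set.\<close>

lemma cochain_complex_Hom_k:
  "cochain_complex
     (Hom_k :: nat \<Rightarrow> (('n::{finite,linorder} sym \<Rightarrow>\<^sub>0 'k::field) \<Rightarrow> ('n, 'k) qalg) set) codiff"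
  unfolding cochain_complex_def
proof (intro allI conjI ballI)
  fix m
  let ?C = "Hom_k :: nat \<Rightarrow> (('n sym \<Rightarrow>\<^sub>0 'k) \<Rightarrow> ('n, 'k) qalg) set"
  note add = hom.subspace_add[OF subspace_Hom_k] and scale = hom.subspace_scale[OF subspace_Hom_k]
  show "hom.subspace (?C m)" by (rule subspace_Hom_k)
  show "codiff m ` ?C m \<subseteq> ?C (Suc m)" using codiff_Hom_k by blast
  show "linear_on (?C m) hscale hscale (codiff m)"
    unfolding linear_on_def
  proof (intro conjI ballI allI)
    fix f g c assume f: "f \<in> ?C m" and g: "g \<in> ?C m"
    show "codiff m (f + g) = codiff m f + codiff m g"
    proof (rule hcoef_eqI)
      show "hcoef (codiff m (f + g)) \<gamma> = hcoef (codiff m f + codiff m g) \<gamma>" for \<gamma>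
      proof -
        obtain J p \<beta> where "\<gamma> = ((J, p), \<beta>)" by (metis surj_pair)
        then show ?thesis
          by (simp add: hcoef_add hcoef_codiff f g add distrib_left sum.distrib)
      qed
    qed (use f g in \<open>auto intro: add codiff_Hom_k\<close>)
    show "codiff m (hscale c f) = hscale c (codiff m f)"
    proof (rule hcoef_eqI)
      show "hcoef (codiff m (hscale c f)) \<gamma> = hcoef (hscale c (codiff m f)) \<gamma>" for \<gamma>
      proof -
        obtain J p \<beta> where "\<gamma> = ((J, p), \<beta>)" by (metis surj_pair)
        then show ?thesis
          by (simp add: hcoef_hscale hcoef_codiff f scale sum_distrib_left mult_ac)
      qed
    qed (use f in \<open>auto intro: scale codiff_Hom_k\<close>)
  qed
  fix g assume g: "g \<in> ?C m"
  have "hcoef (codiff (Suc m) (codiff m g)) ((J, p), \<beta>) = 0" for J p \<beta>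
  proof (rule ccontr)
    assume "hcoef (codiff (Suc m) (codiff m g)) ((J, p), \<beta>) \<noteq> 0"
    then obtain j where j: "keys \<beta> = - {j}"
        "hcoef (codiff m g) ((insert j J, p - 1), \<beta> - cofull_exp j) \<noteq> 0"
      by (rule codiff_support[OF codiff_Hom_k[OF g]])
    from j(2) obtain j' where "j' \<notin> insert j J" "keys (\<beta> - cofull_exp j) = - {j'}"
      by (rule codiff_support[OF g])
    then show False
      using j(1) by (auto simp: keys_eq_Compl_singleton_iff lookup_minus)
  qed
  then show "codiff (Suc m) (codiff m g) = 0"
    by (intro hcoef_eqI[of _ "Suc (Suc m)"])
      (auto intro: codiff_Hom_k g hom.subspace_0[OF subspace_Hom_k])
qed

section \<open>Direct sums from partitions of the standard elements\<close>

lemma is_direct_sum_span_std_elem: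
  fixes S :: "'i \<Rightarrow> 'n::finite std set"
  assumes S: "\<And>j. j \<in> G \<Longrightarrow> S j \<subseteq> {\<gamma> \<in> std_index TYPE('k::field). std_deg \<gamma> = m}"
    and cover: "\<And>\<delta>. \<delta> \<in> std_index TYPE('k) \<Longrightarrow> std_deg \<delta> = m \<Longrightarrow> \<exists>j\<in>G. \<delta> \<in> S j"
    and disj: "\<And>\<delta> i j. i \<in> G \<Longrightarrow> j \<in> G \<Longrightarrow> \<delta> \<in> S i \<Longrightarrow> \<delta> \<in> S j \<Longrightarrow> i = j"
  shows "is_direct_sum (Hom_k m :: (('n sym \<Rightarrow>\<^sub>0 'k) \<Rightarrow> ('n, 'k) qalg) set) G
           (\<lambda>j. hom.span (std_elem ` S j))"
proof -
  let ?C = "Hom_k m :: (('n sym \<Rightarrow>\<^sub>0 'k) \<Rightarrow> ('n, 'k) qalg) set"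
  let ?U = "\<lambda>j. hom.span (std_elem ` S j) :: (('n sym \<Rightarrow>\<^sub>0 'k) \<Rightarrow> ('n, 'k) qalg) set"
  have mem: "f \<in> ?U j \<longleftrightarrow> f \<in> ?C \<and> (\<forall>\<gamma>. hcoef f \<gamma> \<noteq> 0 \<longrightarrow> \<gamma> \<in> S j)" if "j \<in> G" for f j
    using mem_span_std_elem_iff[OF S[OF that]] .
  \<comment> \<open>By disjointness no other summand has a coordinate in \<open>S j\<close>, so each
    component is the restriction of the coordinates of the sum to its own part. Uniqueness
    follows.\<close>
  have unique: "hcoef (w j) \<delta> = (if \<delta> \<in> S j then hcoef (\<Sum>i | w i \<noteq> 0. w i) \<delta> else 0)"
    if w: "\<forall>j\<in>G. w j \<in> ?U j" "\<forall>j. j \<notin> G \<longrightarrow> w j = 0" "finite {j. w j \<noteq> 0}" and j: "j \<in> G"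
    for w j \<delta>
  proof (cases "\<delta> \<in> S j")
    case True
    have "hcoef (w i) \<delta> = 0" if "i \<noteq> j" for i
    proof (cases "i \<in> G")
      case i: True
      then have "\<delta> \<notin> S i" using disj[OF _ j _ True] that by blast
      then show ?thesis using w(1) mem[OF i] i by blast
    qed (use w(2) in simp)
    then have "(\<Sum>i | w i \<noteq> 0. hcoef (w i) \<delta>) = (\<Sum>i | w i \<noteq> 0. if i = j then hcoef (w j) \<delta> else 0)"
      by (intro sum.cong) auto
    also have "\<dots> = hcoef (w j) \<delta>"
      using w(3) by (auto simp: sum.delta)
    finally show ?thesis using True by (simp add: hcoef_sum)
  next
    case False
    then have "hcoef (w j) \<delta> = 0" using w(1) mem[OF j] j by blast
    then show ?thesis using False by simp
  qed
  have ex: "\<exists>!w. (\<forall>j\<in>G. w j \<in> ?U j) \<and> (\<forall>j. j \<notin> G \<longrightarrow> w j = 0) \<and>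
      finite {j. w j \<noteq> 0} \<and> v = (\<Sum>j | w j \<noteq> 0. w j)" if v: "v \<in> ?C" for v
  proof (rule ex_ex1I)
    let ?K = "{\<delta>. hcoef v \<delta> \<noteq> 0}"
    let ?t = "\<lambda>\<delta>. hscale (hcoef v \<delta>) (std_elem \<delta>) :: ('n sym \<Rightarrow>\<^sub>0 'k) \<Rightarrow> ('n, 'k) qalg"
    have fin: "finite ?K" by (rule finite_hcoef[OF v])
    have "\<forall>\<delta>\<in>?K. \<exists>j\<in>G. \<delta> \<in> S j" using cover hcoef_support[OF v] by blast
    \<comment> \<open>\<open>h\<close> picks a part for each index occurring in v; grouping the
      expansion of v along \<open>h\<close> yields the components.\<close>
    then obtain h where h: "\<And>\<delta>. \<delta> \<in> ?K \<Longrightarrow> h \<delta> \<in> G \<and> \<delta> \<in> S (h \<delta>)" by metis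
    define w where "w j = (\<Sum>\<delta> | \<delta> \<in> ?K \<and> h \<delta> = j. ?t \<delta>)" for j
    have z: "w j = 0" if "j \<notin> h ` ?K" for j
      unfolding w_def using that by (intro sum.neutral) auto
    have sub: "{j. w j \<noteq> 0} \<subseteq> h ` ?K" using z by blast
    have "w j \<in> ?U j" for j
      unfolding w_def
      by (intro hom.span_sum hom.span_scale hom.span_base) (use h in auto)
    moreover have "h ` ?K \<subseteq> G" using h by blast
    then have "\<forall>j. j \<notin> G \<longrightarrow> w j = 0" using z by blast
    moreover have "finite {j. w j \<noteq> 0}" using sub fin by (meson finite_imageI finite_subset)
    moreover have "v = (\<Sum>j | w j \<noteq> 0. w j)"
    proof -
      have "(\<Sum>j | w j \<noteq> 0. w j) = (\<Sum>j\<in>h ` ?K. w j)"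
        using sub fin by (intro sum.mono_neutral_left) auto
      also have "\<dots> = (\<Sum>\<delta>\<in>?K. ?t \<delta>)"
        unfolding w_def using fin by (intro sum.group) auto
      finally show ?thesis using hcoef_expansion[OF v] by simp
    qed
    ultimately show "\<exists>w. (\<forall>j\<in>G. w j \<in> ?U j) \<and> (\<forall>j. j \<notin> G \<longrightarrow> w j = 0) \<and>
        finite {j. w j \<noteq> 0} \<and> v = (\<Sum>j | w j \<noteq> 0. w j)" by blast
  next
    fix w w'
    assume w: "(\<forall>j\<in>G. w j \<in> ?U j) \<and> (\<forall>j. j \<notin> G \<longrightarrow> w j = 0) \<and>
        finite {j. w j \<noteq> 0} \<and> v = (\<Sum>j | w j \<noteq> 0. w j)"
      and w': "(\<forall>j\<in>G. w' j \<in> ?U j) \<and> (\<forall>j. j \<notin> G \<longrightarrow> w' j = 0) \<and>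
        finite {j. w' j \<noteq> 0} \<and> v = (\<Sum>j | w' j \<noteq> 0. w' j)"
    show "w = w'"
    proof
      fix j
      show "w j = w' j"
      proof (cases "j \<in> G")
        case True
        show ?thesis
        proof (rule hcoef_eqI)
          show "w j \<in> Hom_k m" "w' j \<in> Hom_k m" using w w' mem True by blast+
          have "hcoef (w j) \<delta> = (if \<delta> \<in> S j then hcoef v \<delta> else 0)" for \<delta>
            using unique[of w j \<delta>] w True by presburger
          moreover have "hcoef (w' j) \<delta> = (if \<delta> \<in> S j then hcoef v \<delta> else 0)" for \<delta>
            using unique[of w' j \<delta>] w' True by presburger
          ultimately show "hcoef (w j) \<delta> = hcoef (w' j) \<delta>" for \<delta> by simp
        qed
      qed (use w w' in simp)
    qed
  qed
  then show ?thesis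
    unfolding is_direct_sum_def using mem by blast
qed

section \<open>The index sets of the subcomplexes and their partition property\<close>

text \<open>Follows the cases of \<open>M_sub\<close> with indices in place of elements; the empty
  set stands for the zero space as its span.\<close>

definition block :: "'n::finite std \<Rightarrow> nat \<Rightarrow> 'n std set" where
  "block = (\<lambda>((I, q), \<alpha>) m.
     if m = card I + 2 * q then {((I, q), \<alpha>)}
     else if m = Suc (card I + 2 * q) then
       {((I - {i}, Suc q), \<alpha> + cofull_exp i) | i. i \<in> I - keys \<alpha>}
     else {})"

lemma M_sub_eq_span_block: "M_sub \<gamma> m = hom.span (std_elem ` block \<gamma> m)"
proof -
  have [simp]: "f ` {g i | i. P i} = {f (g i) | i. P i}" for f :: "'x \<Rightarrow> 'y" and g :: "'z \<Rightarrow> 'x" and P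
    by blast
  obtain I q \<alpha> where "\<gamma> = ((I, q), \<alpha>)" by (metis surj_pair)
  then show ?thesis
    by (simp add: M_sub_def block_def cofull_exp_def)
qed

text \<open>The degree m can be read off the member itself, which replaces the case distinction on m
  by a single equation.\<close>

lemma mem_block_iff:
  "((J, p), \<beta>) \<in> block ((I, q), \<alpha>) m \<longleftrightarrow>
     m = card J + 2 * p \<and> (((J, p), \<beta>) = ((I, q), \<alpha>) \<or>
       (\<exists>i \<in> I - keys \<alpha>. ((J, p), \<beta>) = ((I - {i}, Suc q), \<alpha> + cofull_exp i)))"
proof -
  have "card (I - {i}) + 2 * Suc q = Suc (card I + 2 * q)" if "i \<in> I" for i
    using that card_Suc_Diff1[of I i] by simp
  then show ?thesis
    by (auto simp: block_def)
qed

text \<open>Makes the passage to the target reversible: the sum is zero exactly at i, and there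
  \<open>cofull_exp i\<close> has nothing to subtract.\<close>

lemma add_cofull_exp_iff:
  assumes "i \<notin> keys \<alpha>"
  shows "\<beta> = \<alpha> + cofull_exp i \<longleftrightarrow> keys \<beta> = - {i} \<and> \<alpha> = \<beta> - cofull_exp i"
proof
  assume "\<beta> = \<alpha> + cofull_exp i"
  then show "keys \<beta> = - {i} \<and> \<alpha> = \<beta> - cofull_exp i"
    using assms by (auto simp: keys_eq_Compl_singleton_iff lookup_add in_keys_iff)
next
  assume *: "keys \<beta> = - {i} \<and> \<alpha> = \<beta> - cofull_exp i"
  then have "\<beta> = cofull_exp i + (\<beta> - cofull_exp i)"
    by (intro exp_add_diff) (auto simp: keys_eq_Compl_singleton_iff Suc_le_eq)
  then show "\<beta> = \<alpha> + cofull_exp i" using * by (simp add: add.commute)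
qed

text \<open>In the second case the element is a component of the coboundary of exactly one standard
  element, the one displayed here, because \<open>j\<close> is the only index outside \<open>keys \<beta>\<close>.\<close>

lemma mem_block_unfold:
  "((J, p), \<beta>) \<in> block ((I, q), \<alpha>) m \<longleftrightarrow>
     m = card J + 2 * p \<and> (((I, q), \<alpha>) = ((J, p), \<beta>) \<or>
       (\<exists>j. p \<noteq> 0 \<and> j \<notin> J \<and> keys \<beta> = - {j} \<and>
          ((I, q), \<alpha>) = ((insert j J, p - 1), \<beta> - cofull_exp j)))"
proof -
  have "((J, p), \<beta>) = ((I - {i}, Suc q), \<alpha> + cofull_exp i) \<and> i \<in> I - keys \<alpha> \<longleftrightarrow>
      p \<noteq> 0 \<and> i \<notin> J \<and> keys \<beta> = - {i} \<and>
          ((I, q), \<alpha>) = ((insert i J, p - 1), \<beta> - cofull_exp i)" for i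
  proof (cases "i \<in> keys \<alpha>")
    case True
    \<comment> \<open>With i in the support of \<alpha> both sides are false; on the right, \<alpha>
      would have exponent 0 at i.\<close>
    have "i \<notin> keys (\<beta> - cofull_exp i)" if "keys \<beta> = - {i}"
      using that by (auto simp: keys_eq_Compl_singleton_iff in_keys_iff lookup_minus)
    then show ?thesis using True by auto
  next
    case False
    have "J = I - {i} \<and> i \<in> I \<longleftrightarrow> i \<notin> J \<and> I = insert i J" by auto
    moreover have "p = Suc q \<longleftrightarrow> p \<noteq> 0 \<and> q = p - 1" by auto
    ultimately show ?thesis
      unfolding prod.inject using False add_cofull_exp_iff[OF False, of \<beta>] by blast
  qed
  then show ?thesis unfolding mem_block_iff by blast
qed

lemma keys_minus_cofull_exp:
  assumes "keys \<beta> = - {j}"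
  shows "j \<notin> keys (\<beta> - cofull_exp j)" "keys (\<beta> - cofull_exp j) \<noteq> UNIV"
  using assms
  by (auto simp: keys_eq_Compl_singleton_iff keys_eq_UNIV_iff in_keys_iff lookup_minus)

text \<open>The negated condition on j is the one in the second alternative of
  \<open>mem_block_unfold\<close>, so elements of \<Gamma> are exactly the indices to which that
  alternative cannot apply.\<close>

lemma mem_Gamma_set:
  fixes \<beta> :: "'n::{finite,linorder} \<Rightarrow>\<^sub>0 nat"
  shows "((J, p), \<beta>) \<in> Gamma_set TYPE('k::field) \<longleftrightarrow>
    keys \<beta> \<noteq> UNIV \<and> \<not> (p \<noteq> 0 \<and> (\<exists>j. j \<notin> J \<and> keys \<beta> = - {j}))"
proof -
  let ?\<gamma> = "((J, p), \<beta>)"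
  let ?H = "Hom_k :: nat \<Rightarrow> (('n sym \<Rightarrow>\<^sub>0 'k) \<Rightarrow> ('n, 'k) qalg) set"
  have "?\<gamma> \<in> Gamma_set TYPE('k) \<longleftrightarrow>
      keys \<beta> \<noteq> UNIV \<and> (\<forall>m. \<forall>g\<in>?H m. hcoef (codiff m g) ?\<gamma> = 0)"
    by (cases "keys \<beta> = UNIV")
      (simp_all add: Gamma_set_def mem_std_index representation_std_basis codiff_Hom_k)
  also have "(\<forall>m. \<forall>g\<in>?H m. hcoef (codiff m g) ?\<gamma> = 0) \<longleftrightarrow>
      \<not> (p \<noteq> 0 \<and> (\<exists>j. j \<notin> J \<and> keys \<beta> = - {j}))"
  proof
    assume L: "\<forall>m. \<forall>g\<in>?H m. hcoef (codiff m g) ?\<gamma> = 0"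
    show "\<not> (p \<noteq> 0 \<and> (\<exists>j. j \<notin> J \<and> keys \<beta> = - {j}))"
    proof (rule notI, elim conjE exE)
      fix j assume p: "p \<noteq> 0" and j: "j \<notin> J" "keys \<beta> = - {j}"
      \<comment> \<open>The only possible predecessor. Its coboundary has a sign as coordinate at
        the given index, which is nonzero in every characteristic.\<close>
      let ?\<delta> = "((insert j J, p - 1), \<beta> - cofull_exp j)"
      let ?g = "std_elem ?\<delta> :: ('n sym \<Rightarrow>\<^sub>0 'k) \<Rightarrow> ('n, 'k) qalg"
      have g: "?g \<in> ?H (std_deg ?\<delta>)" by (simp add: std_elem_Hom_k)
      have "{i. i \<notin> J \<and> keys \<beta> = - {i}} = {j}" using j by auto
      moreover have "hcoef ?g ?\<delta> = 1"
        using keys_minus_cofull_exp(2)[OF j(2)] by (simp add: hcoef_std_elem mem_std_index)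
      ultimately have "hcoef (codiff (std_deg ?\<delta>) ?g) ?\<gamma> = sgn_in j J"
        using p by (subst hcoef_codiff[OF g]) simp
      then show False using L g by (simp add: sgn_in_def)
    qed
  next
    assume "\<not> (p \<noteq> 0 \<and> (\<exists>j. j \<notin> J \<and> keys \<beta> = - {j}))"
    then show "\<forall>m. \<forall>g\<in>?H m. hcoef (codiff m g) ?\<gamma> = 0"
      using codiff_support by blast
  qed
  finally show ?thesis .
qed

lemma block_index:
  assumes "\<gamma> \<in> Gamma_set TYPE('k::field)"
  shows "block \<gamma> m \<subseteq> {\<delta> \<in> std_index TYPE('k). std_deg \<delta> = m}"
proof
  fix \<delta> assume \<delta>: "\<delta> \<in> block \<gamma> m"
  obtain J p \<beta> I q \<alpha> where [simp]: "\<delta> = ((J, p), \<beta>)" "\<gamma> = ((I, q), \<alpha>)" by (metis surj_pair)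
  show "\<delta> \<in> {\<delta> \<in> std_index TYPE('k). std_deg \<delta> = m}"
    using \<delta> assms by (auto simp: mem_block_unfold mem_Gamma_set mem_std_index std_deg_def sym_deg_def)
qed

lemma block_cover:
  assumes "\<delta> \<in> std_index TYPE('k::field)" "std_deg \<delta> = m"
  shows "\<exists>\<gamma>\<in>Gamma_set TYPE('k). \<delta> \<in> block \<gamma> m"
proof -
  obtain J p \<beta> where \<delta>: "\<delta> = ((J, p), \<beta>)" by (metis surj_pair)
  have m: "m = card J + 2 * p" using assms(2) by (simp add: \<delta> std_deg_def sym_deg_def)
  show ?thesis
  proof (cases "p \<noteq> 0 \<and> (\<exists>j. j \<notin> J \<and> keys \<beta> = - {j})")
    case True
    then obtain j where j: "p \<noteq> 0" "j \<notin> J" "keys \<beta> = - {j}" by blast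
    let ?\<gamma> = "((insert j J, p - 1), \<beta> - cofull_exp j)"
    \<comment> \<open>An index i with \<open>keys (\<beta> - cofull_exp j) = - {i}\<close> would
      have to be j, which lies in \<open>insert j J\<close>.\<close>
    have "?\<gamma> \<in> Gamma_set TYPE('k)"
      using keys_minus_cofull_exp[OF j(3)] by (auto simp: mem_Gamma_set)
    moreover have "\<delta> \<in> block ?\<gamma> m"
      using j m by (auto simp: \<delta> mem_block_unfold)
    ultimately show ?thesis by blast
  next
    case False
    then have "\<delta> \<in> Gamma_set TYPE('k)" using assms(1) by (simp add: \<delta> mem_Gamma_set mem_std_index)
    moreover have "\<delta> \<in> block \<delta> m" using m by (simp add: \<delta> mem_block_unfold)
    ultimately show ?thesis by blast
  qed
qed

text \<open>Membership in \<Gamma> rules out the mixed case, where \<delta> equals one of the two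
  and is a proper target of the other. If \<delta> is a target of both, the support of its exponent
  fixes j and hence the predecessor.\<close>

lemma block_disjoint:
  assumes "\<gamma> \<in> Gamma_set TYPE('k::field)" "\<gamma>' \<in> Gamma_set TYPE('k)"
    "\<delta> \<in> block \<gamma> m" "\<delta> \<in> block \<gamma>' m"
  shows "\<gamma> = \<gamma>'"
proof -
  obtain J p \<beta> I q \<alpha> I' q' \<alpha>' where
    [simp]: "\<delta> = ((J, p), \<beta>)" "\<gamma> = ((I, q), \<alpha>)" "\<gamma>' = ((I', q'), \<alpha>')"
    by (metis surj_pair)
  show ?thesis
    using assms by (fastforce simp: mem_block_unfold mem_Gamma_set)
qed

section \<open>Stability under the coboundary and the decomposition\<close>

lemma subcomplex_M_sub:
  assumes \<gamma>: "\<gamma> \<in> Gamma_set TYPE('k::field)"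
  shows "subcomplex (M_sub \<gamma>)
    (Hom_k :: nat \<Rightarrow> (('n::{finite,linorder} sym \<Rightarrow>\<^sub>0 'k) \<Rightarrow> ('n, 'k) qalg) set) codiff"
  unfolding subcomplex_def
proof (intro allI conjI)
  fix m
  let ?M = "M_sub \<gamma> :: nat \<Rightarrow> (('n sym \<Rightarrow>\<^sub>0 'k) \<Rightarrow> ('n, 'k) qalg) set"
  have mem: "f \<in> ?M m \<longleftrightarrow> f \<in> Hom_k m \<and> (\<forall>\<delta>. hcoef f \<delta> \<noteq> 0 \<longrightarrow> \<delta> \<in> block \<gamma> m)" for f m
    unfolding M_sub_eq_span_block by (rule mem_span_std_elem_iff[OF block_index[OF \<gamma>]])
  show "hom.subspace (?M m)" unfolding M_sub_eq_span_block by (rule hom.subspace_span)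
  show "?M m \<subseteq> Hom_k m" using mem by blast
  show "codiff m ` ?M m \<subseteq> ?M (Suc m)"
  proof
    fix h assume "h \<in> codiff m ` ?M m"
    then obtain g where h: "h = codiff m g" and g: "g \<in> ?M m" by blast
    have gk: "g \<in> Hom_k m" using g mem by blast
    have hk: "h \<in> Hom_k (Suc m)" using h codiff_Hom_k[OF gk] by simp
    have "\<delta> \<in> block \<gamma> (Suc m)" if nz: "hcoef h \<delta> \<noteq> 0" for \<delta>
    proof -
      obtain J p \<beta> I q \<alpha> where \<delta>: "\<delta> = ((J, p), \<beta>)" and \<gamma>': "\<gamma> = ((I, q), \<alpha>)" by (metis surj_pair)
      have deg: "Suc m = card J + 2 * p"
        using hcoef_support(2)[OF hk nz] by (simp add: \<delta> std_deg_def sym_deg_def)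
      obtain j where j: "p \<noteq> 0" "j \<notin> J" "keys \<beta> = - {j}"
        and nz': "hcoef g ((insert j J, p - 1), \<beta> - cofull_exp j) \<noteq> 0"
        using nz codiff_support[OF gk] unfolding h \<delta> by metis
      have "((insert j J, p - 1), \<beta> - cofull_exp j) \<in> block \<gamma> m"
        using g nz' mem by blast
      \<comment> \<open>A predecessor is never itself a target, so the only member of the block it
        can be is \<gamma>. This settles both degrees at once: from the upper degree no nonzero
        coordinate can arise.\<close>
      moreover have "keys (\<beta> - cofull_exp j) \<noteq> - {i}" if "i \<notin> insert j J" for i
        using keys_minus_cofull_exp(1)[OF j(3)] that by auto
      ultimately have "((I, q), \<alpha>) = ((insert j J, p - 1), \<beta> - cofull_exp j)"
        unfolding \<gamma>' mem_block_unfold by blast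
      then show ?thesis
        unfolding \<gamma>' \<delta> mem_block_unfold using j deg by blast
    qed
    then show "h \<in> ?M (Suc m)" using hk mem by blast
  qed
qed

theorem theorem2p5:
  shows "cochain_complex
           (Hom_k :: nat \<Rightarrow> (('n::{finite,linorder} sym \<Rightarrow>\<^sub>0 'k::field) \<Rightarrow> ('n, 'k) qalg) set) codiff \<and>
         direct_sum_of_subcomplexes
           (Hom_k :: nat \<Rightarrow> (('n sym \<Rightarrow>\<^sub>0 'k) \<Rightarrow> ('n, 'k) qalg) set) codiff (Gamma_set TYPE('k)) M_sub"
  unfolding direct_sum_of_subcomplexes_def
proof (intro conjI ballI allI)
  show "is_direct_sum (Hom_k m :: (('n sym \<Rightarrow>\<^sub>0 'k) \<Rightarrow> ('n, 'k) qalg) set) (Gamma_set TYPE('k))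
      (\<lambda>\<gamma>. M_sub \<gamma> m)" for m
    unfolding M_sub_eq_span_block
    by (rule is_direct_sum_span_std_elem[OF block_index block_cover block_disjoint])
qed (simp_all add: cochain_complex_Hom_k subcomplex_M_sub)

end
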